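(* Let $d\ge4$, let $T$ be a fixed closed $C^1$ subdomain of the unit ball $B_1\subset\mathbb{R}^d$, and for $\varepsilon\in(0,1)$ set $\Omega_\varepsilon:=B_1\setminus\varepsilon T$. Let $f\in L^p(B_1;\mathbb{R}^d)$ for some $d<p<\infty$ be such that $\operatorname{div} f\in L^q(B_1)$ for some $q>d/2$. Suppose that $f$ is independent of $\varepsilon$ and satisfies $$\int_{B_1}\Big(\frac1{|y|^{d-2}}-1\Big)\operatorname{div} f(y)\,dy\neq0 .$$ Then the unique solution $u_\varepsilon\in W^{1,p}_0(\Omega_\varepsilon)$ to $$-\Delta u_\varepsilon=\operatorname{div} f\ \text{ in }\Omega_\varepsilon,\qquad u_\varepsilon=0\ \text{ on }\partial\Omega_\varepsilon=\partial B_1\cup\varepsilon\,\partial T$$ satisfies $$\liminf_{\varepsilon\to0}\|\nabla u_\varepsilon\|_{L^p(\Omega_\varepsilon)}=\infty .$$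
   Context: $B_1:=\{x\in\mathbb{R}^d:|x|<1\}$. $T\subset B_1$ is a closed subdomain with $C^1$ boundary, fixed and independent of $\varepsilon$. $\varepsilon T:=\{\varepsilon x: x\in T\}$. Solutions are weak solutions: $u_\varepsilon\in W^{1,p}_0(\Omega_\varepsilon)$ and $\int_{\Omega_\varepsilon}\nabla u_\varepsilon\cdot\nabla\phi\,dx=-\int_{\Omega_\varepsilon}f\cdot\nabla\phi\,dx$ for all $\phi\in C_c^\infty(\Omega_\varepsilon)$. $\operatorname{div} f$ is the distributional divergence. For each fixed $\varepsilon$ and $1<p<\infty$, existence and uniqueness in $W^{1,p}_0(\Omega_\varepsilon)$ is a known result of Jerison and Kenig. *)

theory Defs
  imports "HOL-Analysis.Analysis"
begin

text \<open>
  The ambient space \<open>\<real>\<^sup>d\<close> is a type of class \<open>euclidean_space\<close> with \<open>d = DIM('a)\<close>. Functions are total;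
  elements of function spaces on \<open>U\<close> are represented by functions of which only the values on
  \<open>U\<close> matter. Integrals are Bochner integrals with respect to Lebesgue measure on \<open>U\<close>.
\<close>

subsection \<open>Differentiability classes and test functions\<close>

text \<open>\<open>C\<^sup>k\<close> on the whole space: all partial derivatives up to order \<open>k\<close> exist and are continuous.\<close>

primrec Ck :: "nat \<Rightarrow> ('a::euclidean_space \<Rightarrow> real) \<Rightarrow> bool" where
  "Ck 0 \<phi> \<longleftrightarrow> continuous_on UNIV \<phi>"
| "Ck (Suc k) \<phi> \<longleftrightarrow> (\<forall>x. \<phi> differentiable (at x)) \<and>
     (\<forall>i\<in>Basis. Ck k (\<lambda>x. frechet_derivative \<phi> (at x) i))"

definition grad :: "('a::euclidean_space \<Rightarrow> real) \<Rightarrow> 'a \<Rightarrow> 'a" where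
  "grad \<phi> x = (\<Sum>i\<in>Basis. frechet_derivative \<phi> (at x) i *\<^sub>R i)"

text \<open>\<open>C\<^sub>c\<^sup>\<infinity>(U)\<close>, its elements being extended by zero to the whole space.\<close>

definition test_functions :: "'a::euclidean_space set \<Rightarrow> ('a \<Rightarrow> real) set" where
  "test_functions U = {\<phi>. (\<forall>k. Ck k \<phi>) \<and>
     compact (closure {x. \<phi> x \<noteq> 0}) \<and> closure {x. \<phi> x \<noteq> 0} \<subseteq> U}"

subsection \<open>Lebesgue spaces\<close>

definition Lp :: "'a::euclidean_space set \<Rightarrow> real \<Rightarrow> ('a \<Rightarrow> 'b::euclidean_space) set" where
  "Lp U p = {f. f \<in> borel_measurable (lebesgue_on U) \<and>
     integrable (lebesgue_on U) (\<lambda>x. norm (f x) powr p)}"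

text \<open>Only meaningful for elements of \<open>Lp U p\<close> (the Bochner integral of a non-integrable function
  is \<open>0\<close>).\<close>

definition Lp_norm :: "'a::euclidean_space set \<Rightarrow> real \<Rightarrow> ('a \<Rightarrow> 'b::euclidean_space) \<Rightarrow> real" where
  "Lp_norm U p f = (\<integral>x. norm (f x) powr p \<partial>lebesgue_on U) powr (1 / p)"

definition locally_integrable ::
    "'a::euclidean_space set \<Rightarrow> ('a \<Rightarrow> 'b::euclidean_space) \<Rightarrow> bool" where
  "locally_integrable U f \<longleftrightarrow> (\<forall>K. compact K \<and> K \<subseteq> U \<longrightarrow> f absolutely_integrable_on K)"

subsection \<open>Weak derivatives and Sobolev spaces\<close>

definition has_weak_grad ::
    "'a::euclidean_space set \<Rightarrow> ('a \<Rightarrow> real) \<Rightarrow> ('a \<Rightarrow> 'a) \<Rightarrow> bool" where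
  "has_weak_grad U u G \<longleftrightarrow> locally_integrable U u \<and> locally_integrable U G \<and>
     (\<forall>\<phi>\<in>test_functions U.
        (\<integral>x. u x *\<^sub>R grad \<phi> x \<partial>lebesgue_on U) = - (\<integral>x. \<phi> x *\<^sub>R G x \<partial>lebesgue_on U))"

text \<open>The weak gradient is determined up to a null set; an arbitrary representative is chosen.\<close>

definition weak_grad :: "'a::euclidean_space set \<Rightarrow> ('a \<Rightarrow> real) \<Rightarrow> 'a \<Rightarrow> 'a" where
  "weak_grad U u = (SOME G. has_weak_grad U u G)"

text \<open>\<open>g\<close> represents the distributional divergence of \<open>f\<close> on \<open>U\<close>.\<close>

definition has_weak_div ::
    "'a::euclidean_space set \<Rightarrow> ('a \<Rightarrow> 'a) \<Rightarrow> ('a \<Rightarrow> real) \<Rightarrow> bool" where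
  "has_weak_div U f g \<longleftrightarrow> locally_integrable U f \<and> locally_integrable U g \<and>
     (\<forall>\<phi>\<in>test_functions U.
        (\<integral>x. g x * \<phi> x \<partial>lebesgue_on U) = - (\<integral>x. f x \<bullet> grad \<phi> x \<partial>lebesgue_on U))"

definition W1p :: "'a::euclidean_space set \<Rightarrow> real \<Rightarrow> ('a \<Rightarrow> real) set" where
  "W1p U p = {u. u \<in> Lp U p \<and> (\<exists>G. has_weak_grad U u G) \<and> weak_grad U u \<in> Lp U p}"

text \<open>\<open>W\<^sub>0\<^sup>1\<^sup>,\<^sup>p(U)\<close> is the closure of \<open>C\<^sub>c\<^sup>\<infinity>(U)\<close> in \<open>W\<^sup>1\<^sup>,\<^sup>p(U)\<close>.\<close>

definition W1p0 :: "'a::euclidean_space set \<Rightarrow> real \<Rightarrow> ('a \<Rightarrow> real) set" where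
  "W1p0 U p = {u \<in> W1p U p. \<exists>\<phi>::nat \<Rightarrow> 'a \<Rightarrow> real. (\<forall>n. \<phi> n \<in> test_functions U) \<and>
     (\<lambda>n. Lp_norm U p (\<lambda>x. \<phi> n x - u x)) \<longlonglongrightarrow> 0 \<and>
     (\<lambda>n. Lp_norm U p (\<lambda>x. grad (\<phi> n) x - weak_grad U u x)) \<longlonglongrightarrow> 0}"

text \<open>Weak solutions in \<open>W\<^sub>0\<^sup>1\<^sup>,\<^sup>p(U)\<close> of \<open>-\<Delta>u = div f\<close> in \<open>U\<close>, \<open>u = 0\<close> on \<open>\<partial>U\<close>.\<close>

definition weak_dirichlet_solution ::
    "'a::euclidean_space set \<Rightarrow> real \<Rightarrow> ('a \<Rightarrow> 'a) \<Rightarrow> ('a \<Rightarrow> real) \<Rightarrow> bool" where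
  "weak_dirichlet_solution U p f u \<longleftrightarrow> u \<in> W1p0 U p \<and>
     (\<forall>\<phi>\<in>test_functions U.
        (\<integral>x. weak_grad U u x \<bullet> grad \<phi> x \<partial>lebesgue_on U) = - (\<integral>x. f x \<bullet> grad \<phi> x \<partial>lebesgue_on U))"

subsection \<open>Domains\<close>

text \<open>Near each boundary point, \<open>D\<close> is the region below the graph of a \<open>C\<^sup>1\<close> function over the
  hyperplane orthogonal to a unit vector \<open>n\<close>. The function \<open>\<psi>\<close> lives on the whole space, but is only
  evaluated on that hyperplane.\<close>

definition C1_domain :: "'a::euclidean_space set \<Rightarrow> bool" where
  "C1_domain D \<longleftrightarrow> open D \<and> connected D \<and> D \<noteq> {} \<and>
     (\<forall>x0\<in>frontier D. \<exists>r>0. \<exists>n \<psi>. norm n = 1 \<and> Ck 1 \<psi> \<and>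
        D \<inter> ball x0 r = {x \<in> ball x0 r. x \<bullet> n < \<psi> (x - (x \<bullet> n) *\<^sub>R n)})"

definition closed_C1_domain :: "'a::euclidean_space set \<Rightarrow> bool" where
  "closed_C1_domain T \<longleftrightarrow> (\<exists>D. C1_domain D \<and> T = closure D)"

definition perforated_ball :: "'a::euclidean_space set \<Rightarrow> real \<Rightarrow> 'a set" where
  "perforated_ball T \<epsilon> = ball 0 1 - (\<lambda>x. \<epsilon> *\<^sub>R x) ` T"

end

theory Submission
  imports Defs
begin

text \<open>
  Write \<open>d\<close> for the dimension and \<open>w = \<nabla>u\<^sub>\<epsilon>\<close>. Test the equation with the Green function
  \<open>|x|\<^sup>2\<^sup>-\<^sup>d - 1\<close> truncated to a function \<open>\<psi>\<^sub>\<epsilon>\<close> that vanishes for \<open>|x| \<le> \<epsilon>\<close>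
  and is unchanged for \<open>|x| \<ge> 2\<epsilon>\<close>. This gives \<open>\<integral>w \<cdot> \<nabla>\<psi>\<^sub>\<epsilon> = \<integral>\<psi>\<^sub>\<epsilon> div f\<close>, and the right-hand side
  tends to \<open>\<integral>(|y|\<^sup>2\<^sup>-\<^sup>d - 1) div f(y) dy \<noteq> 0\<close>. On the left, integrate by parts: \<open>\<Delta>\<psi>\<^sub>\<epsilon>\<close> is \<open>O(\<epsilon>\<^sup>-\<^sup>d)\<close> and
  supported in \<open>B(0,2\<epsilon>)\<close>, and since \<open>u\<^sub>\<epsilon>\<close> vanishes on a ball of radius comparable to \<open>\<epsilon>\<close> inside
  \<open>\<epsilon>T\<close>, Poincare's inequality bounds the \<open>L\<^sup>1\<close> norm of \<open>u\<^sub>\<epsilon>\<close> on \<open>B(0,2\<epsilon>)\<close> by \<open>\<epsilon>\<close> times that of \<open>w\<close>.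
  With Hoelder's inequality the left-hand side is at most a constant times \<open>\<epsilon>\<close> to the power
  \<open>1 - d/p\<close> times the \<open>L\<^sup>p\<close> norm of \<open>w\<close>. As \<open>p > d\<close>, this norm must blow up.
\<close>

subsection \<open>Calculus of \<open>C\<^sup>k\<close> functions\<close>

lemma Ck_Suc_intro:
  assumes "\<And>x. (\<phi> has_derivative \<phi>' x) (at x)"
    and "\<And>i. i \<in> Basis \<Longrightarrow> Ck k (\<lambda>x. \<phi>' x i)"
  shows "Ck (Suc k) \<phi>"
proof -
  have "frechet_derivative \<phi> (at x) = \<phi>' x" for x
    using frechet_derivative_at[OF assms(1)] by simp
  with assms show ?thesis by (auto simp: differentiable_def)
qed

lemma Ck_SucD:
  assumes "Ck (Suc k) \<phi>"
  shows "(\<phi> has_derivative frechet_derivative \<phi> (at x)) (at x)"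
    and "i \<in> Basis \<Longrightarrow> Ck k (\<lambda>x. frechet_derivative \<phi> (at x) i)"
  using assms by (auto simp: frechet_derivative_works[symmetric])

lemma Ck_SucD_Ck: "Ck (Suc k) \<phi> \<Longrightarrow> Ck k \<phi>"
proof (induction k arbitrary: \<phi>)
  case 0
  then show ?case
    by (auto simp: continuous_on_eq_continuous_within intro: differentiable_imp_continuous_within)
next
  case (Suc k)
  then show ?case by (metis Ck.simps(2))
qed

lemma Ck_imp_continuous_on: "Ck k \<phi> \<Longrightarrow> continuous_on UNIV \<phi>"
  by (induction k) (use Ck_SucD_Ck in auto)

lemma Ck_const [simp]: "Ck k (\<lambda>x. c)"
proof (induction k arbitrary: c)
  case (Suc k)
  show ?case by (rule Ck_Suc_intro[where \<phi>' = "\<lambda>x i. 0"]) (auto intro: Suc)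
qed auto

lemma Ck_bounded_linear:
  assumes "bounded_linear l"
  shows "Ck k l"
proof (cases k)
  case 0
  then show ?thesis using assms by (simp add: linear_continuous_on)
next
  case (Suc n)
  show ?thesis unfolding Suc
    by (rule Ck_Suc_intro[where \<phi>' = "\<lambda>x. l"]) (auto intro: assms bounded_linear_imp_has_derivative)
qed

lemma Ck_add: "Ck k \<phi> \<Longrightarrow> Ck k \<psi> \<Longrightarrow> Ck k (\<lambda>x. \<phi> x + \<psi> x)"
proof (induction k arbitrary: \<phi> \<psi>)
  case (Suc k)
  show ?case
    by (rule Ck_Suc_intro[OF has_derivative_add[OF Ck_SucD(1) Ck_SucD(1)]])
      (use Suc in \<open>auto intro!: Suc.IH simp del: Ck.simps dest: Ck_SucD(2)\<close>)
qed (auto intro: continuous_intros)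

lemma Ck_mult: "Ck k \<phi> \<Longrightarrow> Ck k \<psi> \<Longrightarrow> Ck k (\<lambda>x. \<phi> x * \<psi> x)"
proof (induction k arbitrary: \<phi> \<psi>)
  case (Suc k)
  show ?case
    by (rule Ck_Suc_intro[OF has_derivative_mult[OF Ck_SucD(1) Ck_SucD(1)]])
      (use Suc in \<open>auto intro!: Suc.IH Ck_add simp del: Ck.simps dest: Ck_SucD(2) Ck_SucD_Ck\<close>)
qed (auto intro: continuous_intros)

lemma Ck_diff: "Ck k \<phi> \<Longrightarrow> Ck k \<psi> \<Longrightarrow> Ck k (\<lambda>x. \<phi> x - \<psi> x)"
  using Ck_add[of k \<phi> "\<lambda>x. -1 * \<psi> x"] Ck_mult[OF Ck_const[of k "-1"], of \<psi>] by simp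

lemma Ck_sum: "(\<And>i. i \<in> I \<Longrightarrow> Ck k (\<phi> i)) \<Longrightarrow> Ck k (\<lambda>x. \<Sum>i\<in>I. \<phi> i x)"
  by (induction I rule: infinite_finite_induct) (auto intro: Ck_add)

lemma Ck_inner_self: "Ck k (\<lambda>x::'a::euclidean_space. x \<bullet> x)"
  unfolding euclidean_inner[of x x for x :: 'a]
  by (intro Ck_sum Ck_mult Ck_bounded_linear bounded_linear_inner_left)

lemma Ck_Suc_real_intro:
  fixes F :: "real \<Rightarrow> real"
  assumes "\<And>x. (F has_real_derivative F' x) (at x)" and "Ck k F'"
  shows "Ck (Suc k) F"
proof (rule Ck_Suc_intro)
  show "(F has_derivative (*) (F' x)) (at x)" for x
    using assms(1) by (simp add: has_field_derivative_def)
  show "Ck k (\<lambda>x. F' x * i)" if "i \<in> Basis" for i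
    using that assms(2) by simp
qed

lemma Ck_Suc_realD:
  fixes F :: "real \<Rightarrow> real"
  assumes "Ck (Suc k) F"
  shows "(F has_real_derivative deriv F x) (at x)" and "Ck k (deriv F)"
proof -
  have F: "(F has_real_derivative frechet_derivative F (at x) 1) (at x)" for x
  proof -
    have "frechet_derivative F (at x) = (*) (frechet_derivative F (at x) 1)"
    proof
      fix y
      have "linear (frechet_derivative F (at x))"
        using assms by (intro linear_frechet_derivative) simp
      then show "frechet_derivative F (at x) y = frechet_derivative F (at x) 1 * y"
        using linear_scale[of "frechet_derivative F (at x)" y 1] by simp
    qed
    with Ck_SucD(1)[OF assms, of x] show ?thesis
      by (simp add: has_field_derivative_def)
  qed
  then have eq: "deriv F = (\<lambda>x. frechet_derivative F (at x) 1)"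
    using DERIV_imp_deriv by blast
  show "(F has_real_derivative deriv F x) (at x)" "Ck k (deriv F)"
    using F Ck_SucD(2)[OF assms, of 1] by (simp_all add: eq)
qed

text \<open>Both functions are arbitrary in the induction: a partial derivative of the composition
  is one of \<open>g\<close> times \<open>deriv F\<close> composed with \<open>g\<close>. For that
  second factor \<open>g\<close> is used with one order of regularity less.\<close>

lemma Ck_compose:
  fixes F :: "real \<Rightarrow> real"
  shows "Ck k F \<Longrightarrow> Ck k g \<Longrightarrow> Ck k (\<lambda>x. F (g x))"
proof (induction k arbitrary: F g)
  case 0
  then show ?case by (auto intro: continuous_on_compose2)
next
  case (Suc k)
  have "((\<lambda>x. F (g x)) has_derivative (\<lambda>v. frechet_derivative g (at x) v * deriv F (g x))) (at x)" for x
    using has_derivative_compose[OF Ck_SucD(1)[OF Suc.prems(2)],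
        OF Ck_Suc_realD(1)[OF Suc.prems(1), unfolded has_field_derivative_def]]
    by (simp add: mult.commute)
  then show ?case
  proof (rule Ck_Suc_intro)
    show "Ck k (\<lambda>x. frechet_derivative g (at x) i * deriv F (g x))" if "i \<in> Basis" for i
      using Ck_SucD(2)[OF Suc.prems(2) that]
        Suc.IH[OF Ck_Suc_realD(2)[OF Suc.prems(1)] Ck_SucD_Ck[OF Suc.prems(2)]] by (rule Ck_mult)
  qed
qed

text \<open>The exponent is arbitrary in the induction because differentiation lowers it by one.
  Positivity keeps \<open>g\<close> away from 0, where \<open>powr\<close> need not be
  smooth.\<close>

lemma Ck_powr:
  fixes g :: "real \<Rightarrow> real"
  assumes pos: "\<And>x. g x > 0"
  shows "Ck k g \<Longrightarrow> Ck k (\<lambda>x. g x powr s)"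
proof (induction k arbitrary: s)
  case 0
  then show ?case using pos by (auto intro!: continuous_intros simp: less_imp_neq[symmetric])
next
  case (Suc k)
  have "((\<lambda>x. g x powr s) has_real_derivative s * g x powr (s - 1) * deriv g x) (at x)" for x
    using DERIV_fun_powr[OF Ck_Suc_realD(1)[OF Suc.prems], of x s] pos by simp
  then show ?case
  proof (rule Ck_Suc_real_intro)
    show "Ck k (\<lambda>x. s * g x powr (s - 1) * deriv g x)"
      by (intro Ck_mult Ck_const Suc.IH Ck_SucD_Ck[OF Suc.prems] Ck_Suc_realD(2)[OF Suc.prems])
  qed
qed

subsection \<open>A smooth step function\<close>

text \<open>The functions P(1/x) exp(-1/x), extended by zero to x \<le> 0, are closed under
  differentiation: with y = 1/x the derivative is y^2 (P(y) - P'(y)) exp(-y). A single induction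
  over this family then yields all derivatives of exp(-1/x).\<close>

lemma exp_minus_inverse_poly_derivative:
  fixes P :: "real poly"
  defines "E \<equiv> \<lambda>(P::real poly) x. if x > 0 then poly P (1 / x) * exp (- (1 / x)) else (0::real)"
  shows "(E P has_real_derivative E (monom 1 2 * (P - pderiv P)) x) (at x)"
proof -
  consider "x > 0" | "x < 0" | "x = 0" by linarith
  then show ?thesis
  proof cases
    case 1
    have *: "((\<lambda>x. poly P (1 / x) * exp (- (1 / x))) has_real_derivative
       E (monom 1 2 * (P - pderiv P)) x) (at x)"
      using 1 by (auto intro!: derivative_eq_intros DERIV_chain'[where g = "poly P"] poly_DERIV
          simp: E_def poly_monom field_simps power2_eq_square)
    show ?thesis
      by (rule has_field_derivative_transform_within_open[OF *, of "{0<..}"]) (use 1 in \<open>auto simp: E_def\<close>)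
  next
    case 2
    have *: "((\<lambda>x. 0) has_real_derivative E (monom 1 2 * (P - pderiv P)) x) (at x)"
      using 2 by (auto simp: E_def)
    show ?thesis
      by (rule has_field_derivative_transform_within_open[OF *, of "{..<0}"]) (use 2 in \<open>auto simp: E_def\<close>)
  next
    case 3
    have lim: "((\<lambda>y. poly Q y * exp (- y)) \<longlongrightarrow> 0) at_top" for Q :: "real poly"
    proof -
      have "((\<lambda>y. \<Sum>i\<le>degree Q. coeff Q i * (y ^ i / exp y)) \<longlongrightarrow> (\<Sum>i\<le>degree Q. coeff Q i * 0)) at_top"
        by (intro tendsto_intros tendsto_power_div_exp_0)
      then show ?thesis
        by (simp add: poly_altdef sum_distrib_right exp_minus divide_inverse mult.assoc)
    qed
    \<comment> \<open>The factor \<open>monom 1 1\<close> supplies the 1/h of the difference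
      quotient at 0. After substituting y = 1/h, the exponential beats the polynomial.\<close>
    have "((\<lambda>h. poly (monom 1 1 * P) (inverse h) * exp (- inverse h)) \<longlongrightarrow> 0) (at_right 0)"
      using filterlim_compose[OF lim filterlim_inverse_at_top_right] .
    then have "((\<lambda>h. E P h / h) \<longlongrightarrow> 0) (at_right 0)"
      by (rule Lim_transform_eventually)
        (auto simp: E_def eventually_at_right_less poly_monom field_simps intro!: eventually_at_rightI[of 0 1])
    moreover have "((\<lambda>h. E P h / h) \<longlongrightarrow> 0) (at_left 0)"
      by (rule Lim_transform_eventually[OF tendsto_const])
        (auto simp: E_def intro!: eventually_at_leftI[of "-1" 0])
    ultimately have "((\<lambda>h. E P h / h) \<longlongrightarrow> 0) (at 0)"
      by (simp add: filterlim_split_at)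
    moreover have "E Q 0 = 0" for Q
      by (simp add: E_def)
    ultimately show ?thesis
      using 3 by (simp add: DERIV_def)
  qed
qed

text \<open>The witness is e(t-1) / (e(t-1) + e(2-t)), where e(t) is exp(-1/t) for t > 0 and 0
  otherwise. The denominator is positive since t-1 and 2-t are never both nonpositive. Division is
  written as \<open>powr (-1)\<close> so that \<open>Ck_powr\<close> gives smoothness.\<close>

lemma smooth_step_exists:
  obtains \<sigma> :: "real \<Rightarrow> real" where "\<And>k. Ck k \<sigma>" and "\<And>t. t \<le> 1 \<Longrightarrow> \<sigma> t = 0"
    and "\<And>t. t \<ge> 2 \<Longrightarrow> \<sigma> t = 1" and "\<And>t. 0 \<le> \<sigma> t" and "\<And>t. \<sigma> t \<le> 1"
proof -
  define E where "E = (\<lambda>(P::real poly) x. if x > 0 then poly P (1 / x) * exp (- (1 / x)) else (0::real))"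
  have CE: "Ck k (E P)" for k P
  proof (induction k arbitrary: P)
    case 0
    have "(E P has_real_derivative E (monom 1 2 * (P - pderiv P)) x) (at x)" for x
      unfolding E_def by (rule exp_minus_inverse_poly_derivative)
    then show ?case
      using DERIV_isCont continuous_at_imp_continuous_on by (metis Ck.simps(1))
  next
    case (Suc k)
    show ?case
      by (rule Ck_Suc_real_intro[where F' = "E (monom 1 2 * (P - pderiv P))", OF _ Suc])
        (unfold E_def, rule exp_minus_inverse_poly_derivative)
  qed
  define e where "e = E 1"
  have e0: "e t = 0" if "t \<le> 0" for t using that by (simp add: e_def E_def)
  have epos: "e t > 0" if "t > 0" for t using that by (simp add: e_def E_def)
  have enn: "e t \<ge> 0" for t using e0[of t] epos[of t] by linarith
  define D where "D t = e (t - 1) + e (2 - t)" for t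
  have D: "D t > 0" for t
    using enn[of "t - 1"] enn[of "2 - t"] epos[of "t - 1"] epos[of "2 - t"] by (fastforce simp: D_def)
  have C1: "Ck k (\<lambda>t. e (t - 1))" for k
    by (rule Ck_compose[where F = e], unfold e_def, rule CE)
      (intro Ck_diff Ck_const Ck_bounded_linear bounded_linear_ident)
  have C2: "Ck k (\<lambda>t. e (2 - t))" for k
    by (rule Ck_compose[where F = e], unfold e_def, rule CE)
      (intro Ck_diff Ck_const Ck_bounded_linear bounded_linear_ident)
  show thesis
  proof (rule that)
    show "Ck k (\<lambda>t. e (t - 1) * D t powr (-1))" for k
      by (intro Ck_mult C1 Ck_powr D) (unfold D_def, intro Ck_add C1 C2)
    show "e (t - 1) * D t powr (-1) = 0" if "t \<le> 1" for t using that e0 by simp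
    show "e (t - 1) * D t powr (-1) = 1" if "t \<ge> 2" for t
      using that e0[of "2 - t"] D[of t] by (simp add: D_def powr_minus)
    show "e (t - 1) * D t powr (-1) \<ge> 0" for t using enn by simp
    show "e (t - 1) * D t powr (-1) \<le> 1" for t
      using enn[of "2 - t"] D[of t] by (simp add: D_def powr_minus field_simps)
  qed
qed

subsection \<open>Gradients\<close>

lemma has_derivative_grad:
  assumes "Ck 1 \<phi>"
  shows "(\<phi> has_derivative (\<lambda>v. grad \<phi> x \<bullet> v)) (at x)"
proof -
  have d: "(\<phi> has_derivative frechet_derivative \<phi> (at x)) (at x)"
    using Ck_SucD(1)[of 0] assms by simp
  interpret bounded_linear "frechet_derivative \<phi> (at x)"
    by (rule has_derivative_bounded_linear[OF d])
  have "frechet_derivative \<phi> (at x) v = grad \<phi> x \<bullet> v" for v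
  proof -
    have "frechet_derivative \<phi> (at x) v = frechet_derivative \<phi> (at x) (\<Sum>i\<in>Basis. (v \<bullet> i) *\<^sub>R i)"
      by (simp add: euclidean_representation)
    also have "\<dots> = grad \<phi> x \<bullet> v"
      by (simp add: sum scaleR grad_def inner_sum_left inner_commute[of v] mult.commute)
    finally show ?thesis .
  qed
  then have "frechet_derivative \<phi> (at x) = (\<lambda>v. grad \<phi> x \<bullet> v)" by (rule ext)
  with d show ?thesis by simp
qed

lemma has_derivative_imp_grad_eq:
  assumes "(\<phi> has_derivative (\<lambda>v. g \<bullet> v)) (at x)"
  shows "grad \<phi> x = g"
  unfolding grad_def frechet_derivative_at[OF assms, symmetric] by (simp add: euclidean_representation)

lemma continuous_on_grad: "Ck 1 \<phi> \<Longrightarrow> continuous_on UNIV (grad \<phi>)"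
  unfolding grad_def by (auto intro!: continuous_on_sum continuous_on_scaleR)

lemma Ck_1_inner_grad: "Ck 1 \<phi> \<Longrightarrow> i \<in> Basis \<Longrightarrow> frechet_derivative \<phi> (at x) i = grad \<phi> x \<bullet> i"
  by (simp add: grad_def inner_sum_left inner_Basis if_distrib sum.delta cong: if_cong)

lemma grad_eq_0_of_eventually:
  assumes "eventually (\<lambda>y. \<phi> y = 0) (nhds x)"
  shows "grad \<phi> x = 0"
proof -
  have "(\<phi> has_derivative (\<lambda>v. 0 \<bullet> v)) (at x)"
  proof (rule has_derivative_transform_eventually[where f = "\<lambda>y. 0"])
    show "\<forall>\<^sub>F y in at x. 0 = \<phi> y"
      using assms by (auto simp: eventually_at_filter elim: eventually_mono)
    show "0 = \<phi> x" using eventually_nhds_x_imp_x[OF assms] by simp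
  qed auto
  then show ?thesis by (rule has_derivative_imp_grad_eq)
qed

lemma grad_eq_0_outside_closure:
  assumes "x \<notin> closure {y. \<phi> y \<noteq> 0}"
  shows "grad \<phi> x = 0"
proof (rule grad_eq_0_of_eventually)
  have "open (- closure {y. \<phi> y \<noteq> 0})" by auto
  then show "\<forall>\<^sub>F y in nhds x. \<phi> y = 0"
    unfolding eventually_nhds
    using assms closure_subset[of "{y. \<phi> y \<noteq> 0}"] by (intro exI[of _ "- closure {y. \<phi> y \<noteq> 0}"]) auto
qed

lemma has_derivative_inner_self: "((\<lambda>x. x \<bullet> x) has_derivative (\<lambda>v. 2 * (x \<bullet> v))) (at x)"
  by (auto intro!: derivative_eq_intros simp: inner_commute)

text \<open>Radial functions are written throughout as functions of the squared norm. This is a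
  polynomial, so the origin needs no separate treatment.\<close>

lemma grad_radial:
  fixes F :: "real \<Rightarrow> real"
  assumes "(F has_real_derivative D) (at (x \<bullet> x))"
  shows "grad (\<lambda>x. F (x \<bullet> x)) x = (2 * D) *\<^sub>R x"
proof (rule has_derivative_imp_grad_eq)
  show "((\<lambda>x. F (x \<bullet> x)) has_derivative (\<lambda>v. ((2 * D) *\<^sub>R x) \<bullet> v)) (at x)"
    using has_derivative_compose[OF has_derivative_inner_self assms[unfolded has_field_derivative_def]]
    by (simp add: mult_ac)
qed

subsection \<open>Integration by parts\<close>

lemma integrable_compact_support:
  fixes f :: "'a::euclidean_space \<Rightarrow> 'b::euclidean_space"
  assumes "continuous_on UNIV f" and "compact K" and "\<And>x. x \<notin> K \<Longrightarrow> f x = 0"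
  shows "integrable lborel f"
proof -
  have "integrable lborel (\<lambda>x. indicator K x *\<^sub>R f x)"
    using assms by (intro borel_integrable_compact) (auto intro: continuous_on_subset)
  also have "(\<lambda>x. indicator K x *\<^sub>R f x) = f"
    using assms(3) by (auto simp: indicator_def fun_eq_iff)
  finally show ?thesis .
qed

lemma continuous_on_compact_norm_bound:
  fixes f :: "'a::topological_space \<Rightarrow> 'b::real_normed_vector"
  assumes "compact K" and "continuous_on UNIV f"
  obtains M where "M \<ge> 0" and "\<And>x. x \<in> K \<Longrightarrow> norm (f x) \<le> M"
proof -
  have "bounded (f ` K)"
    using assms by (intro compact_imp_bounded compact_continuous_image) (auto intro: continuous_on_subset)
  then obtain a where "\<forall>y\<in>f ` K. norm y \<le> a" unfolding bounded_iff by blast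
  then have "norm (f x) \<le> \<bar>a\<bar>" if "x \<in> K" for x using that by force
  then show thesis using that[of "\<bar>a\<bar>"] by simp
qed

lemma continuous_zero_outside_compact_bounded:
  fixes H :: "'a::topological_space \<Rightarrow> real"
  assumes "continuous_on UNIV H" and "compact K" and "\<And>t. t \<notin> K \<Longrightarrow> H t = 0"
  obtains M where "M \<ge> 0" and "\<And>t. \<bar>H t\<bar> \<le> M"
proof -
  obtain M where M: "M \<ge> 0" "\<And>x. x \<in> K \<Longrightarrow> norm (H x) \<le> M"
    using continuous_on_compact_norm_bound[OF assms(2,1)] by blast
  then have "\<bar>H t\<bar> \<le> M" for t using assms(3)[of t] by (cases "t \<in> K") auto
  with M(1) show thesis using that by blast
qed

text \<open>Each difference quotient of \<open>w\<close> has integral zero because Lebesgue measure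
  is translation invariant; dominated convergence carries this over to the derivative.\<close>

lemma integral_frechet_derivative_eq_0:
  fixes w :: "'a::euclidean_space \<Rightarrow> real"
  assumes w: "Ck 1 w" and K: "compact K" "\<And>x. x \<notin> K \<Longrightarrow> w x = 0" and i: "i \<in> Basis"
  shows "integral\<^sup>L lborel (\<lambda>x. frechet_derivative w (at x) i) = 0"
proof -
  define g where "g x = grad w x \<bullet> i" for x
  have gc: "continuous_on UNIV g"
    unfolding g_def by (intro continuous_intros continuous_on_grad w)
  have wc: "continuous_on UNIV w" using Ck_imp_continuous_on[OF w] .
  have g0: "g x = 0" if "x \<notin> K" for x
  proof -
    have "closure {y. w y \<noteq> 0} \<subseteq> K"
      using K by (intro closure_minimal compact_imp_closed) auto
    with that have "grad w x = 0"
      by (intro grad_eq_0_outside_closure) auto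
    then show ?thesis by (simp add: g_def)
  qed
  obtain M where M: "M \<ge> 0" "\<And>x. \<bar>g x\<bar> \<le> M"
    using continuous_zero_outside_compact_bounded[OF gc K(1) g0] by blast
  obtain R where R: "R > 0" "K \<subseteq> cball 0 R"
    using compact_imp_bounded[OF K(1)] unfolding bounded_pos by (metis mem_cball_0 subsetI)
  define h where "h n = 1 / (real n + 1)" for n
  have h: "h n > 0" "h n \<le> 1" for n by (auto simp: h_def)
  have h_lim: "h \<longlonglongrightarrow> 0" unfolding h_def using LIMSEQ_inverse_real_of_nat by (simp add: inverse_eq_divide add.commute)
  define s where "s n x = (w (x + h n *\<^sub>R i) - w x) / h n" for n x
  have wi: "integrable lborel w" by (rule integrable_compact_support[OF wc K])
  have tr: "integrable lborel (\<lambda>x. w (x + c))" "integral\<^sup>L lborel (\<lambda>x. w (x + c)) = integral\<^sup>L lborel w" for c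
  proof -
    have m: "w \<in> borel_measurable borel" using wc by (rule borel_measurable_continuous_onI)
    have "integrable (distr lborel borel ((+) c)) w" using wi by (simp add: lborel_distr_plus)
    then show "integrable lborel (\<lambda>x. w (x + c))"
      using m by (simp add: integrable_distr_eq add.commute)
    have "integral\<^sup>L (distr lborel borel ((+) c)) w = integral\<^sup>L lborel (\<lambda>x. w (c + x))"
      using m by (intro integral_distr) auto
    then show "integral\<^sup>L lborel (\<lambda>x. w (x + c)) = integral\<^sup>L lborel w"
      by (simp add: lborel_distr_plus add.commute)
  qed
  have s0: "integral\<^sup>L lborel (s n) = 0" for n
    unfolding s_def using tr[of "h n *\<^sub>R i"] wi by simp
  have der: "((\<lambda>t. w (x + t *\<^sub>R i)) has_real_derivative g (x + t *\<^sub>R i)) (at t)" for x t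
  proof -
    have 1: "((\<lambda>t. x + t *\<^sub>R i) has_derivative (\<lambda>t. t *\<^sub>R i)) (at t)"
      by (auto intro!: derivative_eq_intros)
    show ?thesis
      unfolding has_field_derivative_def
      by (rule has_derivative_eq_rhs[OF has_derivative_compose[OF 1 has_derivative_grad[OF w]]])
        (simp add: g_def fun_eq_iff)
  qed
  have "(\<lambda>n. integral\<^sup>L lborel (s n)) \<longlonglongrightarrow> integral\<^sup>L lborel g"
  proof (rule integral_dominated_convergence[where w = "\<lambda>x. M * indicator (cball 0 (R + 1)) x"])
    show "g \<in> borel_measurable lborel"
      using borel_measurable_continuous_onI[OF gc] by simp
    show "s n \<in> borel_measurable lborel" for n
      unfolding s_def using tr(1)[of "h n *\<^sub>R i"] wi by simp
    show "integrable lborel (\<lambda>x::'a. M * indicator (cball 0 (R + 1)) x :: real)"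
      using emeasure_lborel_cball_finite[of "0::'a" "R + 1"]
      by (intro integrable_mult_right integrable_real_indicator) auto
    show "AE x in lborel. (\<lambda>n. s n x) \<longlonglongrightarrow> g x"
    proof (rule AE_I2)
      fix x
      have "((\<lambda>t. (w (x + t *\<^sub>R i) - w x) / t) \<longlongrightarrow> g x) (at 0)"
        using der[of x 0] by (simp add: DERIV_def)
      moreover have "filterlim h (at 0) sequentially"
        using h_lim h by (auto simp: filterlim_at less_imp_neq[symmetric] intro!: always_eventually)
      ultimately show "(\<lambda>n. s n x) \<longlonglongrightarrow> g x"
        unfolding s_def by (rule filterlim_compose)
    qed
    \<comment> \<open>The mean value theorem bounds the quotient by the maximum of the derivative. A
      step of length at most 1 cannot bring a point from outside radius \<open>R + 1\<close> into
      \<open>K\<close>, so the quotient vanishes there.\<close>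
    show "AE x in lborel. norm (s n x) \<le> M * indicator (cball 0 (R + 1)) x" for n
    proof (rule AE_I2)
      fix x :: 'a
      show "norm (s n x) \<le> M * indicator (cball 0 (R + 1)) x"
      proof (cases "x \<in> cball 0 (R + 1)")
        case True
        obtain \<theta> where "w (x + h n *\<^sub>R i) - w (x + 0 *\<^sub>R i) = (h n - 0) * g (x + \<theta> *\<^sub>R i)"
          using MVT2[OF h(1)[of n], of "\<lambda>t. w (x + t *\<^sub>R i)" "\<lambda>t. g (x + t *\<^sub>R i)"] der by blast
        then have "s n x = g (x + \<theta> *\<^sub>R i)" using h(1)[of n] by (simp add: s_def)
        then show ?thesis using True M by simp
      next
        case False
        then have "norm (x + h n *\<^sub>R i) > R"
          using norm_triangle_ineq2[of x "- (h n *\<^sub>R i)"] h[of n] i by (auto simp: dist_norm)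
        then have "x \<notin> K" "x + h n *\<^sub>R i \<notin> K" using R(2) False by auto
        then show ?thesis using K M by (simp add: s_def)
      qed
    qed
  qed
  then have "integral\<^sup>L lborel g = 0"
    using s0 by (simp add: LIMSEQ_const_iff)
  then show ?thesis
    using Ck_1_inner_grad[OF w i] unfolding g_def[abs_def] by simp
qed

text \<open>This is the divergence theorem for the compactly supported field \<phi>(x) q(|x|^2) x,
  obtained by summing the previous lemma over its components. The factor 2 t q'(t) + d q(t) at t =
  |x|^2 is the divergence of q(|x|^2) x.\<close>

lemma integral_grad_inner_radial_field:
  fixes \<phi> :: "'a::euclidean_space \<Rightarrow> real"
  assumes \<phi>: "Ck 1 \<phi>" and K: "compact K" "\<And>x. x \<notin> K \<Longrightarrow> \<phi> x = 0" and q: "Ck 1 q"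
  shows "integral\<^sup>L lborel (\<lambda>x. grad \<phi> x \<bullet> (q (x \<bullet> x) *\<^sub>R x)) =
    - integral\<^sup>L lborel (\<lambda>x. \<phi> x * (2 * (x \<bullet> x) * deriv q (x \<bullet> x) + real DIM('a) * q (x \<bullet> x)))"
proof -
  define w where "w i x = \<phi> x * (q (x \<bullet> x) * (x \<bullet> i))" for i x
  have Cw: "Ck 1 (w i)" for i
    unfolding w_def
    by (rule Ck_mult[OF \<phi> Ck_mult[OF Ck_compose[OF q Ck_inner_self]
      Ck_bounded_linear[OF bounded_linear_inner_left]]])
  have qd: "(q has_real_derivative deriv q t) (at t)" for t
    using Ck_Suc_realD(1)[of 0 q] q by simp
  have qc: "continuous_on UNIV q" "continuous_on UNIV (deriv q)"
    using Ck_imp_continuous_on[OF q] Ck_Suc_realD(2)[of 0 q] q by auto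
  have qc': "continuous_on UNIV (\<lambda>x::'a. q (x \<bullet> x))" "continuous_on UNIV (\<lambda>x::'a. deriv q (x \<bullet> x))"
    by (auto intro!: continuous_on_compose2[OF qc(1)] continuous_on_compose2[OF qc(2)] continuous_intros)
  have dw: "(w i has_derivative (\<lambda>v. \<phi> x * (q (x \<bullet> x) * (v \<bullet> i) + (2 * (x \<bullet> v)) * deriv q (x \<bullet> x) * (x \<bullet> i))
      + (grad \<phi> x \<bullet> v) * (q (x \<bullet> x) * (x \<bullet> i)))) (at x)" for i x
  proof -
    have "((\<lambda>x. q (x \<bullet> x)) has_derivative (\<lambda>v. deriv q (x \<bullet> x) * (2 * (x \<bullet> v)))) (at x)"
      using has_derivative_compose[OF has_derivative_inner_self qd[unfolded has_field_derivative_def]] .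
    from has_derivative_mult[OF has_derivative_grad[OF \<phi>]
        has_derivative_mult[OF this has_derivative_inner_left[OF has_derivative_ident]]]
    show ?thesis unfolding w_def by (rule has_derivative_eq_rhs) (auto simp: algebra_simps)
  qed
  have fw: "frechet_derivative (w i) (at x) i =
      \<phi> x * (q (x \<bullet> x) + 2 * (x \<bullet> i)^2 * deriv q (x \<bullet> x)) + (grad \<phi> x \<bullet> i) * (q (x \<bullet> x) * (x \<bullet> i))"
    if "i \<in> Basis" for i x
    using that by (simp add: frechet_derivative_at[OF dw, symmetric] power2_eq_square algebra_simps)
  let ?A = "\<lambda>x. grad \<phi> x \<bullet> (q (x \<bullet> x) *\<^sub>R x)"
  let ?B = "\<lambda>x. \<phi> x * (2 * (x \<bullet> x) * deriv q (x \<bullet> x) + real DIM('a) * q (x \<bullet> x))"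
  have eq: "(\<Sum>i\<in>Basis. frechet_derivative (w i) (at x) i) = ?A x + ?B x" for x
  proof -
    have "(\<Sum>i\<in>Basis. frechet_derivative (w i) (at x) i) =
        (\<Sum>i\<in>Basis. \<phi> x * q (x \<bullet> x) + 2 * \<phi> x * deriv q (x \<bullet> x) * ((x \<bullet> i) * (x \<bullet> i))
          + q (x \<bullet> x) * ((grad \<phi> x \<bullet> i) * (x \<bullet> i)))"
      using fw by (intro sum.cong) (auto simp: power2_eq_square algebra_simps)
    also have "\<dots> = real DIM('a) * (\<phi> x * q (x \<bullet> x)) + 2 * \<phi> x * deriv q (x \<bullet> x) * (x \<bullet> x)
        + q (x \<bullet> x) * (grad \<phi> x \<bullet> x)"
      by (simp add: sum.distrib sum_distrib_left[symmetric] euclidean_inner[symmetric])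
    finally show ?thesis by (simp add: algebra_simps)
  qed
  have gsupp: "grad \<phi> x = 0" if "x \<notin> K" for x
  proof -
    have "closure {y. \<phi> y \<noteq> 0} \<subseteq> K"
      using K by (intro closure_minimal compact_imp_closed) auto
    with that show ?thesis by (auto intro!: grad_eq_0_outside_closure)
  qed
  have A: "integrable lborel ?A"
    using gsupp by (intro integrable_compact_support[OF _ K(1)] continuous_intros continuous_on_grad \<phi> qc') auto
  have B: "integrable lborel ?B"
    using K(2) by (intro integrable_compact_support[OF _ K(1)] continuous_intros qc' Ck_imp_continuous_on[OF \<phi>]) auto
  have I: "integrable lborel (\<lambda>x. frechet_derivative (w i) (at x) i)" if "i \<in> Basis" for i
    unfolding fw[OF that]
    using K(2) gsupp by (intro integrable_compact_support[OF _ K(1)] continuous_intros continuous_on_grad \<phi> qc' Ck_imp_continuous_on[OF \<phi>]) auto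
  have "integral\<^sup>L lborel ?A + integral\<^sup>L lborel ?B = integral\<^sup>L lborel (\<lambda>x. \<Sum>i\<in>Basis. frechet_derivative (w i) (at x) i)"
    unfolding eq using A B by simp
  also have "\<dots> = (\<Sum>i\<in>Basis. integral\<^sup>L lborel (\<lambda>x. frechet_derivative (w i) (at x) i))"
    by (rule Bochner_Integration.integral_sum) (rule I)
  also have "\<dots> = 0"
    using K by (intro sum.neutral ballI integral_frechet_derivative_eq_0[OF Cw K(1)]) (auto simp: w_def)
  finally show ?thesis by simp
qed

subsection \<open>A Poincare inequality\<close>

text \<open>The ray from \<open>z\<close> to \<open>x\<close> only meets the set where \<open>\<phi>\<close> may be nonzero at parameters \<open>t \<ge> t0\<close>,
  where the dilation \<open>x \<mapsto> z + t(x - z)\<close> distorts volume by at most \<open>t0\<^sup>-\<^sup>d\<close>.\<close>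

lemma poincare_along_rays:
  fixes \<phi> :: "'a::euclidean_space \<Rightarrow> real"
  assumes \<phi>: "Ck 1 \<phi>" and z: "z \<in> ball 0 R" and t0: "0 < t0" "t0 \<le> 1"
    and zero: "\<And>x. dist z x < 2 * R * t0 \<Longrightarrow> \<phi> x = 0"
  shows "(\<integral>\<^sup>+x. ennreal \<bar>\<phi> x\<bar> * indicator (ball 0 R) x \<partial>lborel)
    \<le> ennreal (2 * R / t0 ^ DIM('a)) * (\<integral>\<^sup>+x. ennreal (norm (grad \<phi> x)) * indicator (ball 0 R) x \<partial>lborel)"
proof -
  let ?B = "ball (0::'a) R"
  let ?p = "\<lambda>t x. z + t *\<^sub>R (x - z)"
  have R: "R > 0" using z by (metis mem_ball order.strict_trans1 zero_le_dist)
  define N where "N x = ennreal (norm (grad \<phi> x)) * indicator ?B x" for x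
  have gm: "(\<lambda>x. norm (grad \<phi> x)) \<in> borel_measurable borel"
    by (intro borel_measurable_continuous_onI continuous_intros continuous_on_grad \<phi>)
  have [measurable]: "?B \<in> sets borel" by simp
  have Nm [measurable]: "N \<in> borel_measurable borel"
    unfolding N_def using gm by measurable
  \<comment> \<open>Segments from \<open>z\<close> to points of the ball stay in the ball by
    convexity. Hence the indicator inside \<open>N\<close> may be evaluated at the moved point,
    which prepares the change of variables over the whole space.\<close>
  have pB: "?p t x \<in> ?B" if "x \<in> ?B" "t \<in> {t0..1}" for t x
  proof -
    have "?p t x = (1 - t) *\<^sub>R z + t *\<^sub>R x" by (simp add: algebra_simps)
    also have "\<dots> \<in> ?B"
      using that t0 z convexD_alt[of ?B z x t] by auto
    finally show ?thesis .
  qed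
  have pm [measurable]: "(\<lambda>(x, t). ?p t x) \<in> borel_measurable (borel \<Otimes>\<^sub>M borel)"
    unfolding borel_prod case_prod_beta
    by (intro borel_measurable_continuous_onI continuous_intros)
  have pt: "ennreal \<bar>\<phi> x\<bar> * indicator ?B x \<le>
      ennreal (2 * R) * (\<integral>\<^sup>+t. N (?p t x) * indicator {t0..1} t \<partial>lborel)" for x
  proof (cases "x \<in> ?B")
    case True
    have d: "((\<lambda>t. \<phi> (?p t x)) has_real_derivative grad \<phi> (?p t x) \<bullet> (x - z)) (at t)" for t
    proof -
      have 1: "((\<lambda>t. ?p t x) has_derivative (\<lambda>t. t *\<^sub>R (x - z))) (at t)"
        by (auto intro!: derivative_eq_intros)
      show ?thesis
        unfolding has_field_derivative_def
        by (rule has_derivative_eq_rhs[OF has_derivative_compose[OF 1 has_derivative_grad[OF \<phi>]]])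
          (simp add: fun_eq_iff)
    qed
    have xz: "norm (x - z) \<le> 2 * R" "dist x z < 2 * R"
      using True z norm_triangle_ineq4[of x z] by (auto simp: dist_norm)
    \<comment> \<open>Two points of the ball are less than 2R apart, so the point at parameter
      \<open>t0\<close> lies within 2R t0 of \<open>z\<close>, where \<phi> vanishes. The
      fundamental theorem of calculus thus recovers \<phi>(x) from the ray derivative on [t0, 1]
      alone.\<close>
    have "\<phi> (?p t0 x) = 0"
      using xz t0 by (intro zero) (auto simp: dist_norm mult.commute norm_minus_commute)
    moreover have "((\<lambda>t. grad \<phi> (?p t x) \<bullet> (x - z)) has_integral \<phi> (?p 1 x) - \<phi> (?p t0 x)) {t0..1}"
      using t0 d by (intro fundamental_theorem_of_calculus)
        (auto simp: has_real_derivative_iff_has_vector_derivative[symmetric] intro: has_field_derivative_at_within)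
    ultimately have I: "((\<lambda>t. grad \<phi> (?p t x) \<bullet> (x - z)) has_integral \<phi> x) {t0..1}" by simp
    have gpc: "continuous_on {t0..1} (\<lambda>t. grad \<phi> (?p t x))"
      by (rule continuous_on_compose2[OF continuous_on_grad[OF \<phi>]]) (auto intro!: continuous_intros)
    have c: "continuous_on {t0..1} (\<lambda>t. norm (grad \<phi> (?p t x)) * (2 * R))"
      by (intro continuous_intros gpc)
    have "norm (integral {t0..1} (\<lambda>t. grad \<phi> (?p t x) \<bullet> (x - z)))
        \<le> integral {t0..1} (\<lambda>t. norm (grad \<phi> (?p t x)) * (2 * R))"
    proof (rule integral_norm_bound_integral)
      show "(\<lambda>t. norm (grad \<phi> (?p t x)) * (2 * R)) integrable_on {t0..1}"
        using c by (rule integrable_continuous_interval)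
      show "norm (grad \<phi> (?p t x) \<bullet> (x - z)) \<le> norm (grad \<phi> (?p t x)) * (2 * R)" for t
        using Cauchy_Schwarz_ineq2[of "grad \<phi> (?p t x)" "x - z"]
          mult_left_mono[OF xz(1), of "norm (grad \<phi> (?p t x))"] by simp
    qed (use I in auto)
    then have "\<bar>\<phi> x\<bar> \<le> integral {t0..1} (\<lambda>t. norm (grad \<phi> (?p t x)) * (2 * R))"
      using integral_unique[OF I] by simp
    then have "ennreal \<bar>\<phi> x\<bar> \<le> ennreal (integral {t0..1} (\<lambda>t. norm (grad \<phi> (?p t x)) * (2 * R)))"
      by (rule ennreal_leI)
    also have "\<dots> = (\<integral>\<^sup>+t. ennreal (indicator {t0..1} t * (norm (grad \<phi> (?p t x)) * (2 * R))) \<partial>lborel)"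
    proof -
      have *: "((\<lambda>t. norm (grad \<phi> (?p t x)) * (2 * R)) has_integral
          integral {t0..1} (\<lambda>t. norm (grad \<phi> (?p t x)) * (2 * R))) {t0..1}"
        using integrable_continuous_interval[OF c] by (rule integrable_integral)
      show ?thesis
        using R nn_integral_has_integral_lebesgue[OF _ *] by simp
    qed
    also have "\<dots> = (\<integral>\<^sup>+t. ennreal (2 * R) * (N (?p t x) * indicator {t0..1} t) \<partial>lborel)"
      using pB[OF True] R
      by (intro nn_integral_cong) (auto simp: N_def indicator_def ennreal_mult' mult.commute)
    also have "\<dots> = ennreal (2 * R) * (\<integral>\<^sup>+t. N (?p t x) * indicator {t0..1} t \<partial>lborel)"
      by (rule nn_integral_cmult) (use measurable_Pair2[OF pm, of x] in \<open>simp; measurable\<close>)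
    finally show ?thesis using True by simp
  qed auto
  have N2: "(\<lambda>(x, t). N (?p t x) * indicator {t0..1} t) \<in> borel_measurable (lborel \<Otimes>\<^sub>M lborel)"
    using measurable_compose[OF pm Nm] by (simp add: case_prod_beta) measurable
  have "(\<integral>\<^sup>+x. ennreal \<bar>\<phi> x\<bar> * indicator ?B x \<partial>lborel)
      \<le> (\<integral>\<^sup>+x. ennreal (2 * R) * (\<integral>\<^sup>+t. N (?p t x) * indicator {t0..1} t \<partial>lborel) \<partial>lborel)"
    by (intro nn_integral_mono pt)
  also have "\<dots> = ennreal (2 * R) * (\<integral>\<^sup>+x. (\<integral>\<^sup>+t. N (?p t x) * indicator {t0..1} t \<partial>lborel) \<partial>lborel)"
    using lborel.borel_measurable_nn_integral[OF N2] by (intro nn_integral_cmult) (simp add: case_prod_beta)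
  \<comment> \<open>For nonnegative integrals the exchange needs only joint measurability. For fixed
    \<open>t\<close> the inner integral is then an affine change of variables with Jacobian
    t^d.\<close>
  also have "(\<integral>\<^sup>+x. (\<integral>\<^sup>+t. N (?p t x) * indicator {t0..1} t \<partial>lborel) \<partial>lborel)
      = (\<integral>\<^sup>+t. (\<integral>\<^sup>+x. N (?p t x) * indicator {t0..1} t \<partial>lborel) \<partial>lborel)"
    using lborel_pair.Fubini'[OF N2] by simp
  also have "\<dots> \<le> (\<integral>\<^sup>+t. ennreal (1 / t0 ^ DIM('a)) * integral\<^sup>N lborel N * indicator {t0..1} t \<partial>lborel)"
  proof (rule nn_integral_mono)
    fix t :: real
    show "(\<integral>\<^sup>+x. N (?p t x) * indicator {t0..1} t \<partial>lborel)
        \<le> ennreal (1 / t0 ^ DIM('a)) * integral\<^sup>N lborel N * indicator {t0..1} t"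
    proof (cases "t \<in> {t0..1}")
      case True
      then have t: "t > 0" using t0 by auto
      have p_eq: "?p t x = (z - t *\<^sub>R z) + t *\<^sub>R x" for x by (simp add: algebra_simps)
      have m: "(\<lambda>x. N (?p t x)) \<in> borel_measurable borel"
        by (rule measurable_compose[OF _ Nm]) (intro borel_measurable_continuous_onI continuous_intros)
      have "integral\<^sup>N lborel N = integral\<^sup>N (density (distr lborel borel (?p t)) (\<lambda>_. \<bar>t\<bar> ^ DIM('a))) N"
        unfolding p_eq using lborel_affine[of t "z - t *\<^sub>R z"] t by simp
      also have "\<dots> = ennreal (t ^ DIM('a)) * (\<integral>\<^sup>+x. N (?p t x) \<partial>lborel)"
        using t m by (simp add: nn_integral_density nn_integral_distr nn_integral_cmult)
      finally have e: "ennreal (t ^ DIM('a)) * (\<integral>\<^sup>+x. N (?p t x) \<partial>lborel) = integral\<^sup>N lborel N" by simp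
      have "(\<integral>\<^sup>+x. N (?p t x) \<partial>lborel)
          = ennreal (1 / t ^ DIM('a)) * (ennreal (t ^ DIM('a)) * (\<integral>\<^sup>+x. N (?p t x) \<partial>lborel))"
        using t by (simp add: mult.assoc[symmetric] ennreal_mult[symmetric])
      also have "\<dots> \<le> ennreal (1 / t0 ^ DIM('a)) * integral\<^sup>N lborel N"
        unfolding e using True t0 t
        by (intro mult_right_mono ennreal_leI divide_left_mono power_mono) auto
      finally show ?thesis using True by simp
    qed simp
  qed
  also have "\<dots> = ennreal (1 / t0 ^ DIM('a)) * integral\<^sup>N lborel N * ennreal (1 - t0)"
    using t0 by (simp add: nn_integral_cmult)
  \<comment> \<open>The parameter interval has length \<open>1 - t0\<close>, which is at most
    1.\<close>
  also have "\<dots> \<le> ennreal (1 / t0 ^ DIM('a)) * integral\<^sup>N lborel N * 1"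
    using t0 by (intro mult_left_mono) auto
  finally have "(\<integral>\<^sup>+x. ennreal \<bar>\<phi> x\<bar> * indicator ?B x \<partial>lborel)
      \<le> ennreal (2 * R) * (ennreal (1 / t0 ^ DIM('a)) * integral\<^sup>N lborel N)"
    by (simp add: mult_left_mono)
  also have "\<dots> = ennreal (2 * R / t0 ^ DIM('a)) * integral\<^sup>N lborel N"
    using R t0 by (simp add: mult.assoc[symmetric] ennreal_mult[symmetric])
  finally show ?thesis unfolding N_def .
qed

section \<open>Test functions paired with scaled radial gradient fields\<close>

lemma deriv_eq_0_of_const_on_open:
  fixes F :: "real \<Rightarrow> real"
  assumes "open S" and "t \<in> S" and "\<And>s. s \<in> S \<Longrightarrow> F s = c"
  shows "deriv F t = 0"
proof -
  have "(F has_real_derivative 0) (at t)"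
    by (rule has_field_derivative_transform_within_open[OF DERIV_const[of c] assms(1,2)])
      (simp add: assms(3))
  then show ?thesis by (rule DERIV_imp_deriv)
qed

lemma test_functions_Ck: "\<phi> \<in> test_functions U \<Longrightarrow> Ck k \<phi>"
  by (simp add: test_functions_def)

lemma test_functions_outside:
  assumes "\<phi> \<in> test_functions U" and "x \<notin> U"
  shows "\<phi> x = 0" and "grad \<phi> x = 0"
proof -
  have "x \<notin> closure {y. \<phi> y \<noteq> 0}" using assms by (auto simp: test_functions_def)
  then show "\<phi> x = 0" "grad \<phi> x = 0"
    using closure_subset[of "{y. \<phi> y \<noteq> 0}"] grad_eq_0_outside_closure by auto
qed

lemma Ck_scale: "Ck k F \<Longrightarrow> Ck k (\<lambda>t::real. F (c * t))"
  by (rule Ck_compose[OF _ Ck_mult[OF Ck_const Ck_bounded_linear[OF bounded_linear_ident]]])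

lemma deriv_scale:
  fixes F :: "real \<Rightarrow> real"
  assumes "Ck (Suc k) F"
  shows "((\<lambda>t. F (c * t)) has_real_derivative c * deriv F (c * t)) (at t)"
proof -
  have "((\<lambda>t. c * t) has_real_derivative c) (at t)" by (auto intro!: derivative_eq_intros)
  from DERIV_chain2[OF Ck_Suc_realD(1)[OF assms] this] show ?thesis by (simp add: mult.commute)
qed

text \<open>Here \<open>4tF'' + 2dF'\<close> is the Laplacian of \<open>x \<mapsto> F(|x|\<^sup>2)\<close>, written in terms of \<open>t = |x|\<^sup>2\<close>.\<close>

lemma radial_pairing_bound:
  fixes F :: "real \<Rightarrow> real" and z :: "'a::euclidean_space"
  assumes F: "Ck 2 F"
    and harmonic: "\<And>t. t \<notin> {1..2} \<Longrightarrow> 4 * t * deriv (deriv F) t + 2 * real DIM('a) * deriv F t = 0"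
    and z: "z \<in> ball 0 1" and \<rho>: "0 < \<rho>" "\<rho> \<le> 1"
  obtains C where "C \<ge> 0" and
    "\<And>\<epsilon> \<phi>. \<epsilon> > 0 \<Longrightarrow> \<phi> \<in> test_functions UNIV \<Longrightarrow>
      \<forall>x. dist (\<epsilon> *\<^sub>R z) x < \<epsilon> * \<rho> \<longrightarrow> \<phi> x = 0 \<Longrightarrow>
      \<bar>integral\<^sup>L lborel (\<lambda>x::'a. grad \<phi> x \<bullet> ((2 / \<epsilon>\<^sup>2 * deriv F ((x \<bullet> x) / \<epsilon>\<^sup>2)) *\<^sub>R x))\<bar>
        \<le> C / \<epsilon> * integral\<^sup>L lborel (\<lambda>x. indicator (ball 0 (2 * \<epsilon>)) x * norm (grad \<phi> x))"
proof -
  have F2: "Ck (Suc (Suc 0)) F" using F by (simp only: numeral_2_eq_2)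
  have dF: "Ck (Suc 0) (deriv F)" using Ck_Suc_realD(2)[OF F2] .
  have ddF: "Ck 0 (deriv (deriv F))" using Ck_Suc_realD(2)[OF dF] .
  define H where "H t = 4 * t * deriv (deriv F) t + 2 * real DIM('a) * deriv F t" for t
  have Hc: "continuous_on UNIV H"
    unfolding H_def by (intro continuous_intros Ck_imp_continuous_on[OF dF] Ck_imp_continuous_on[OF ddF])
  obtain M where M: "M \<ge> 0" "\<And>t. \<bar>H t\<bar> \<le> M"
    using continuous_zero_outside_compact_bounded[OF Hc compact_Icc, of 1 2] harmonic by (auto simp: H_def)
  \<comment> \<open>The Poincare inequality is applied on the ball of radius R = 2\<epsilon>; the
    quarter makes 2 R t0 equal to \<epsilon> \<rho>, the radius on which \<phi> is known to
    vanish.\<close>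
  define t0 where "t0 = \<rho> / 4"
  have t0: "0 < t0" "t0 \<le> 1" using \<rho> by (auto simp: t0_def)
  define C where "C = M * (4 / t0 ^ DIM('a))"
  show thesis
  proof (rule that)
    show "C \<ge> 0" using M t0 by (simp add: C_def)
    fix \<epsilon> :: real and \<phi> :: "'a \<Rightarrow> real"
    assume \<epsilon>: "\<epsilon> > 0" and test: "\<phi> \<in> test_functions UNIV"
      and zero: "\<forall>x. dist (\<epsilon> *\<^sub>R z) x < \<epsilon> * \<rho> \<longrightarrow> \<phi> x = 0"
    have \<phi>: "Ck 1 \<phi>" using test by (rule test_functions_Ck)
    define K where "K = closure {x. \<phi> x \<noteq> 0}"
    have K: "compact K" "\<And>x. x \<notin> K \<Longrightarrow> \<phi> x = 0"
      using test closure_subset[of "{x. \<phi> x \<noteq> 0}"] by (auto simp: K_def test_functions_def)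
    let ?B = "ball (0::'a) (2 * \<epsilon>)"
    \<comment> \<open>With this \<open>q\<close>, the field q(|x|^2) x is the gradient of F(|x|^2 /
      \<epsilon>^2). Its divergence is therefore \<open>H\<close> at the rescaled argument, divided
      by \<epsilon>^2.\<close>
    define q where "q t = 2 / \<epsilon>\<^sup>2 * deriv F (1 / \<epsilon>\<^sup>2 * t)" for t
    have q: "Ck 1 q"
      unfolding q_def One_nat_def by (rule Ck_mult[OF Ck_const Ck_scale[OF dF]])
    have dq: "deriv q t = 2 / \<epsilon>\<^sup>2 * (1 / \<epsilon>\<^sup>2 * deriv (deriv F) (1 / \<epsilon>\<^sup>2 * t))" for t
      unfolding q_def by (rule DERIV_imp_deriv[OF DERIV_cmult[OF deriv_scale[OF dF]]])
    have qH: "2 * t * deriv q t + real DIM('a) * q t = H (t / \<epsilon>\<^sup>2) / \<epsilon>\<^sup>2" for t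
      using \<epsilon> by (simp add: dq q_def H_def field_simps)
    have \<phi>c: "continuous_on UNIV \<phi>" using Ck_imp_continuous_on[OF \<phi>] .
    have gsupp: "grad \<phi> x = 0" if "x \<notin> K" for x
      using that unfolding K_def by (rule grad_eq_0_outside_closure)
    have Bm: "?B \<in> sets lborel" by simp
    have i1: "integrable lborel (\<lambda>x. indicator ?B x * \<bar>\<phi> x\<bar>)"
      using integrable_real_mult_indicator[OF Bm, of "\<lambda>x. \<bar>\<phi> x\<bar>"]
        integrable_abs[OF integrable_compact_support[OF \<phi>c K]] by (simp add: mult.commute)
    have i2: "integrable lborel (\<lambda>x. indicator ?B x * norm (grad \<phi> x))"
      using integrable_real_mult_indicator[OF Bm, of "\<lambda>x. norm (grad \<phi> x)"]
        integrable_norm[OF integrable_compact_support[OF continuous_on_grad[OF \<phi>] K(1) gsupp]]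
      by (simp add: mult.commute)
    have poincare: "integral\<^sup>L lborel (\<lambda>x. indicator ?B x * \<bar>\<phi> x\<bar>)
        \<le> 4 * \<epsilon> / t0 ^ DIM('a) * integral\<^sup>L lborel (\<lambda>x. indicator ?B x * norm (grad \<phi> x))"
    proof -
      have "ennreal (integral\<^sup>L lborel (\<lambda>x. indicator ?B x * \<bar>\<phi> x\<bar>))
          = (\<integral>\<^sup>+x. ennreal \<bar>\<phi> x\<bar> * indicator ?B x \<partial>lborel)"
        by (subst nn_integral_eq_integral[OF i1, symmetric])
          (auto intro!: nn_integral_cong simp: indicator_def)
      also have "\<dots> \<le> ennreal (2 * (2 * \<epsilon>) / t0 ^ DIM('a)) *
          (\<integral>\<^sup>+x. ennreal (norm (grad \<phi> x)) * indicator ?B x \<partial>lborel)"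
      proof (rule poincare_along_rays[OF \<phi> _ t0])
        show "\<epsilon> *\<^sub>R z \<in> ?B" using z \<epsilon> by (simp add: dist_norm)
        show "\<phi> x = 0" if "dist (\<epsilon> *\<^sub>R z) x < 2 * (2 * \<epsilon>) * t0" for x
          using zero that by (simp add: t0_def)
      qed
      also have "(\<integral>\<^sup>+x. ennreal (norm (grad \<phi> x)) * indicator ?B x \<partial>lborel)
          = ennreal (integral\<^sup>L lborel (\<lambda>x. indicator ?B x * norm (grad \<phi> x)))"
        by (subst nn_integral_eq_integral[OF i2, symmetric])
          (auto intro!: nn_integral_cong simp: indicator_def)
      finally show ?thesis
        using \<epsilon> t0 by (simp add: ennreal_mult[symmetric] integral_nonneg_AE)
    qed
    have "integral\<^sup>L lborel (\<lambda>x. grad \<phi> x \<bullet> ((2 / \<epsilon>\<^sup>2 * deriv F ((x \<bullet> x) / \<epsilon>\<^sup>2)) *\<^sub>R x))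
        = - integral\<^sup>L lborel (\<lambda>x. \<phi> x * (H ((x \<bullet> x) / \<epsilon>\<^sup>2) / \<epsilon>\<^sup>2))"
      using integral_grad_inner_radial_field[OF \<phi> K q] unfolding qH by (simp add: q_def)
    also have "\<bar>\<dots>\<bar> \<le> integral\<^sup>L lborel (\<lambda>x. M / \<epsilon>\<^sup>2 * (indicator ?B x * \<bar>\<phi> x\<bar>))"
      unfolding abs_minus_cancel unfolding real_norm_def[symmetric]
    proof (rule Bochner_Integration.integral_norm_bound_integral)
      show "integrable lborel (\<lambda>x. \<phi> x * (H ((x \<bullet> x) / \<epsilon>\<^sup>2) / \<epsilon>\<^sup>2))"
        using K(2) by (intro integrable_compact_support[OF _ K(1)] continuous_intros \<phi>c
            continuous_on_compose2[OF Hc]) (use \<epsilon> in auto)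
      show "integrable lborel (\<lambda>x. M / \<epsilon>\<^sup>2 * (indicator ?B x * norm (\<phi> x)))"
        using i1 by simp
      fix x :: 'a
      show "norm (\<phi> x * (H ((x \<bullet> x) / \<epsilon>\<^sup>2) / \<epsilon>\<^sup>2)) \<le> M / \<epsilon>\<^sup>2 * (indicator ?B x * norm (\<phi> x))"
      proof (cases "x \<in> ?B")
        case True
        then show ?thesis
          using mult_right_mono[OF M(2)[of "(x \<bullet> x) / \<epsilon>\<^sup>2"], of "\<bar>\<phi> x\<bar>"] \<epsilon>
          by (simp add: abs_mult field_simps)
      next
        case False
        then have "(2 * \<epsilon>)\<^sup>2 \<le> (norm x)\<^sup>2" using \<epsilon> by (intro power_mono) auto
        \<comment> \<open>The range \<open>{1..2}\<close> of the rescaled squared norm, the only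
          place where \<open>H\<close> may be nonzero, corresponds to radii at most sqrt 2 times
          \<epsilon>, hence lies within the ball of radius 2\<epsilon>.\<close>
        then have "(x \<bullet> x) / \<epsilon>\<^sup>2 \<ge> 4"
          using \<epsilon> by (simp add: field_simps power2_norm_eq_inner power_mult_distrib)
        then have "H ((x \<bullet> x) / \<epsilon>\<^sup>2) = 0"
          unfolding H_def by (intro harmonic) auto
        then show ?thesis using M by simp
      qed
    qed
    also have "\<dots> = M / \<epsilon>\<^sup>2 * integral\<^sup>L lborel (\<lambda>x. indicator ?B x * \<bar>\<phi> x\<bar>)" by simp
    also have "\<dots> \<le> M / \<epsilon>\<^sup>2 * (4 * \<epsilon> / t0 ^ DIM('a) * integral\<^sup>L lborel (\<lambda>x. indicator ?B x * norm (grad \<phi> x)))"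
      using M by (intro mult_left_mono[OF poincare]) auto
    also have "\<dots> = C / \<epsilon> * integral\<^sup>L lborel (\<lambda>x. indicator ?B x * norm (grad \<phi> x))"
      using \<epsilon> t0 by (simp add: C_def power2_eq_square field_simps)
    finally show "\<bar>integral\<^sup>L lborel (\<lambda>x::'a. grad \<phi> x \<bullet> ((2 / \<epsilon>\<^sup>2 * deriv F ((x \<bullet> x) / \<epsilon>\<^sup>2)) *\<^sub>R x))\<bar>
        \<le> C / \<epsilon> * integral\<^sup>L lborel (\<lambda>x. indicator (ball 0 (2 * \<epsilon>)) x * norm (grad \<phi> x))" .
  qed
qed

subsection \<open>\<open>L\<^sup>p\<close> estimates\<close>

text \<open>The factor 2 comes from using \<open>a \<le> l + l\<^sup>1\<^sup>-\<^sup>p a\<^sup>p\<close> instead of Hoelder's inequality.\<close>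

lemma integral_indicator_norm_le_Lp:
  fixes f :: "'a \<Rightarrow> 'b::{banach, second_countable_topology}"
  assumes p: "p > 1" and f: "f \<in> borel_measurable M" "integrable M (\<lambda>x. norm (f x) powr p)"
    and S: "S \<in> sets M" "emeasure M S < \<infinity>"
  shows "integrable M (\<lambda>x. indicator S x * norm (f x))"
    and "integral\<^sup>L M (\<lambda>x. indicator S x * norm (f x))
      \<le> 2 * measure M S powr (1 - 1 / p) * (integral\<^sup>L M (\<lambda>x. norm (f x) powr p)) powr (1 / p)"
proof -
  let ?I = "integral\<^sup>L M (\<lambda>x. indicator S x * norm (f x))"
  let ?J = "integral\<^sup>L M (\<lambda>x. norm (f x) powr p)"
  \<comment> \<open>Where |f| \<le> l the first term is enough. Where |f| > l, the power with
    negative exponent 1 - p is decreasing, so |f| = |f|^(1-p) |f|^p is at most l^(1-p)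
    |f|^p.\<close>
  have pt: "indicator S x * norm (f x) \<le> l * indicator S x + l powr (1 - p) * norm (f x) powr p"
    if l: "l > 0" for l x
  proof (cases "x \<in> S \<and> norm (f x) > l")
    case True
    then have "norm (f x) = norm (f x) powr (1 - p) * norm (f x) powr p"
      using l by (simp add: powr_add[symmetric])
    also have "\<dots> \<le> l powr (1 - p) * norm (f x) powr p"
      using True l p by (intro mult_right_mono powr_mono2') auto
    finally show ?thesis using True l by (simp add: add_increasing)
  next
    case False
    then show ?thesis using l by (auto simp: indicator_def add_increasing2)
  qed
  have iS: "integrable M (indicator S :: 'a \<Rightarrow> real)" using S by simp
  have ib: "integrable M (\<lambda>x. l * indicator S x + l powr (1 - p) * norm (f x) powr p)" for l
    using iS f by simp
  show int: "integrable M (\<lambda>x. indicator S x * norm (f x))"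
  proof (rule Bochner_Integration.integrable_bound[OF ib[of 1]])
    show "(\<lambda>x. indicator S x * norm (f x)) \<in> borel_measurable M" using f S by measurable
    show "AE x in M. norm (indicator S x * norm (f x)) \<le> norm (1 * indicator S x + 1 powr (1 - p) * norm (f x) powr p)"
      using pt[of 1] by (auto simp: abs_mult intro: order_trans)
  qed
  have bound: "?I \<le> l * measure M S + l powr (1 - p) * ?J" if "l > 0" for l
  proof -
    have "?I \<le> integral\<^sup>L M (\<lambda>x. l * indicator S x + l powr (1 - p) * norm (f x) powr p)"
      using pt[OF that] by (intro integral_mono int ib)
    also have "\<dots> = l * measure M S + l powr (1 - p) * ?J"
      using iS f S by simp
    finally show ?thesis .
  qed
  have J: "?J \<ge> 0" by (simp add: integral_nonneg_AE)
  \<comment> \<open>The optimal level \<open>l\<close> requires both quantities to be positive. In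
    the degenerate cases either \<open>S\<close> is null or \<open>l\<close> can be taken
    arbitrarily small.\<close>
  consider "measure M S = 0" | "?J = 0" | "measure M S > 0" "?J > 0"
    using J measure_nonneg[of M S] by linarith
  then show "?I \<le> 2 * measure M S powr (1 - 1 / p) * ?J powr (1 / p)"
  proof cases
    case 1
    then have "emeasure M S = 0" using S(2) by (auto simp: measure_def enn2real_eq_0_iff)
    then have "AE x in M. x \<notin> S" using S by (auto intro: AE_not_in)
    then have "?I = 0" by (intro integral_eq_zero_AE) auto
    then show ?thesis using 1 by simp
  next
    case 2
    have "?I \<le> 0 + e" if "e > 0" for e
    proof -
      have "?I \<le> e / (measure M S + 1) * measure M S"
        using bound[of "e / (measure M S + 1)"] 2 that by (simp add: add_nonneg_pos)
      also have "\<dots> \<le> e"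
        using that measure_nonneg[of M S] by (simp add: field_simps add_pos_nonneg)
      finally show ?thesis by simp
    qed
    then have "?I \<le> 0" by (rule field_le_epsilon)
    then show ?thesis using 2 p by simp
  next
    case 3
    define m j where "m = measure M S" and "j = ?J"
    have mj: "m > 0" "j > 0" using 3 by (simp_all add: m_def j_def)
    \<comment> \<open>This level balances the two terms of \<open>bound\<close>: with l =
      (j/m)^(1/p), both l m and l^(1-p) j equal m^(1-1/p) j^(1/p), whence the factor 2.\<close>
    define l where "l = j powr (1 / p) * m powr (- (1 / p))"
    have l: "l > 0" using mj by (simp add: l_def)
    have "l * m = j powr (1 / p) * (m powr (- (1 / p)) * m powr 1)"
      using mj by (simp add: l_def)
    also have "\<dots> = j powr (1 / p) * m powr (1 - 1 / p)"
      unfolding powr_add[symmetric] by simp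
    finally have 1: "l * m = m powr (1 - 1 / p) * j powr (1 / p)" by simp
    have "l powr (1 - p) * j = (j powr ((1 / p) * (1 - p)) * j powr 1) * m powr (- (1 / p) * (1 - p))"
      using mj by (simp add: l_def powr_mult powr_powr)
    also have "\<dots> = j powr (1 / p) * m powr (1 - 1 / p)"
    proof -
      have "(1 / p) * (1 - p) + 1 = 1 / p" "- (1 / p) * (1 - p) = 1 - 1 / p"
        using p by (simp_all add: field_simps)
      then show ?thesis unfolding powr_add[symmetric] by (simp only:)
    qed
    finally have 2: "l powr (1 - p) * j = m powr (1 - 1 / p) * j powr (1 / p)" by simp
    show ?thesis using bound[OF l] 1 2 by (simp add: m_def j_def)
  qed
qed

lemma lebesgue_on_integral_eq_lborel:
  fixes f :: "'a::euclidean_space \<Rightarrow> real"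
  assumes "U \<in> sets lebesgue" and "f \<in> borel_measurable borel" and "\<And>x. x \<notin> U \<Longrightarrow> f x = 0"
  shows "integral\<^sup>L (lebesgue_on U) f = integral\<^sup>L lborel f"
proof -
  have "integral\<^sup>L (lebesgue_on U) f = integral\<^sup>L lebesgue (\<lambda>x. indicator U x *\<^sub>R f x)"
    using assms by (intro integral_restrict_space) auto
  also have "(\<lambda>x. indicator U x *\<^sub>R f x) = f"
    using assms(3) by (auto simp: indicator_def fun_eq_iff)
  also have "integral\<^sup>L lebesgue f = integral\<^sup>L lborel f"
    using assms by (intro integral_completion) auto
  finally show ?thesis .
qed

text \<open>The previous estimate with \<open>U\<close> itself as the set gives the inclusion of L^p
  in L^1 on sets of finite measure.\<close>

lemma Lp_imp_integrable:
  assumes U: "U \<in> lmeasurable" and p: "p > 1" and f: "f \<in> Lp U p"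
  shows "integrable (lebesgue_on U) f"
proof -
  have "integrable (lebesgue_on U) (\<lambda>x. indicator U x * norm (f x))"
  proof (rule integral_indicator_norm_le_Lp(1)[OF p])
    show "U \<in> sets (lebesgue_on U)" using U by (auto simp: sets_restrict_space_iff fmeasurable_def)
    show "emeasure (lebesgue_on U) U < \<infinity>"
      using U by (auto simp: emeasure_restrict_space fmeasurable_def)
  qed (use f in \<open>auto simp: Lp_def\<close>)
  then have "integrable (lebesgue_on U) (\<lambda>x. norm (f x))"
    by (rule Bochner_Integration.integrable_cong[THEN iffD1, rotated -1]) (auto simp: space_restrict_space)
  then show ?thesis
    using f by (subst integrable_norm_iff[symmetric]) (auto simp: Lp_def)
qed

text \<open>A pointwise stand-in for Minkowski's inequality: it serves to show that differences stay
  in L^p, for which no sharp constant matters.\<close>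

lemma powr_norm_diff_le:
  fixes a b :: "'a::real_normed_vector"
  assumes "p > 0"
  shows "norm (a - b) powr p \<le> 2 powr p * norm a powr p + 2 powr p * norm b powr p"
proof -
  have "norm (a - b) powr p \<le> (2 * max (norm a) (norm b)) powr p"
    using norm_triangle_ineq4[of a b] assms by (intro powr_mono2) auto
  also have "\<dots> = 2 powr p * max (norm a) (norm b) powr p" by (simp add: powr_mult)
  also have "\<dots> \<le> 2 powr p * norm a powr p + 2 powr p * norm b powr p"
    by (auto simp: max_def)
  finally show ?thesis .
qed

lemma Lp_diff:
  assumes p: "p > 0" and U: "U \<in> sets lebesgue" and f: "f \<in> Lp U p" and g: "g \<in> Lp U p"
  shows "(\<lambda>x. f x - g x) \<in> Lp U p"
proof -
  have m: "(\<lambda>x. f x - g x) \<in> borel_measurable (lebesgue_on U)" using f g by (auto simp: Lp_def)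
  have i: "integrable (lebesgue_on U) (\<lambda>x. 2 powr p * norm (f x) powr p + 2 powr p * norm (g x) powr p)"
    using f g by (auto simp: Lp_def)
  have "integrable (lebesgue_on U) (\<lambda>x. norm (f x - g x) powr p)"
    by (rule Bochner_Integration.integrable_bound[OF i])
      (use m powr_norm_diff_le[OF p] in \<open>auto simp: abs_of_nonneg\<close>)
  then show ?thesis using m by (simp add: Lp_def)
qed

lemma bounded_continuous_in_Lp:
  fixes f :: "'a::euclidean_space \<Rightarrow> 'b::euclidean_space"
  assumes U: "U \<in> lmeasurable" and p: "p > 0" and f: "continuous_on UNIV f" "\<And>x. x \<in> U \<Longrightarrow> norm (f x) \<le> M"
  shows "f \<in> Lp U p"
proof -
  have m: "f \<in> borel_measurable (lebesgue_on U)"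
    using U f(1) by (intro continuous_imp_measurable_on_sets_lebesgue) (auto intro: continuous_on_subset fmeasurableD)
  have "finite_measure (lebesgue_on U)" using U by (rule finite_measure_lebesgue_on)
  then have "integrable (lebesgue_on U) (\<lambda>x. norm (f x) powr p)"
    by (rule finite_measure.integrable_const_bound[where B = "M powr p"])
      (use m f(2) p in \<open>auto intro!: AE_I2 powr_mono2 simp: space_restrict_space\<close>)
  then show ?thesis using m by (simp add: Lp_def)
qed

lemma lebesgue_on_integral_norm_inner_bound:
  fixes f :: "'a::euclidean_space \<Rightarrow> 'a"
  assumes U: "U \<in> sets lebesgue" and f: "integrable (lebesgue_on U) f"
    and G: "continuous_on UNIV G" "\<And>x. x \<in> U \<Longrightarrow> norm (G x) \<le> M"
  shows "integrable (lebesgue_on U) (\<lambda>x. f x \<bullet> G x)"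
    and "\<bar>integral\<^sup>L (lebesgue_on U) (\<lambda>x. f x \<bullet> G x)\<bar> \<le> M * integral\<^sup>L (lebesgue_on U) (\<lambda>x. norm (f x))"
proof -
  have Gm: "G \<in> borel_measurable (lebesgue_on U)"
    using U G(1) by (intro continuous_imp_measurable_on_sets_lebesgue) (auto intro: continuous_on_subset)
  have b: "norm (f x \<bullet> G x) \<le> M * norm (f x)" if "x \<in> U" for x
    using Cauchy_Schwarz_ineq2[of "f x" "G x"] mult_left_mono[OF G(2)[OF that], of "norm (f x)"]
    by (simp add: mult.commute)
  have i: "integrable (lebesgue_on U) (\<lambda>x. M * norm (f x))" using f by simp
  show *: "integrable (lebesgue_on U) (\<lambda>x. f x \<bullet> G x)"
  proof (rule Bochner_Integration.integrable_bound[OF i])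
    show "(\<lambda>x. f x \<bullet> G x) \<in> borel_measurable (lebesgue_on U)" using f Gm by measurable
    show "AE x in lebesgue_on U. norm (f x \<bullet> G x) \<le> norm (M * norm (f x))"
      by (rule AE_I2) (use b in \<open>force simp: space_restrict_space\<close>)
  qed
  have "norm (integral\<^sup>L (lebesgue_on U) (\<lambda>x. f x \<bullet> G x)) \<le> integral\<^sup>L (lebesgue_on U) (\<lambda>x. M * norm (f x))"
    by (rule Bochner_Integration.integral_norm_bound_integral[OF * i])
      (use b in \<open>auto simp: space_restrict_space\<close>)
  then show "\<bar>integral\<^sup>L (lebesgue_on U) (\<lambda>x. f x \<bullet> G x)\<bar> \<le> M * integral\<^sup>L (lebesgue_on U) (\<lambda>x. norm (f x))"
    by simp
qed

text \<open>The pairing estimate is available for test functions and is carried over to their L^p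
  limit. On a bounded \<open>U\<close>, L^p convergence implies L^1 convergence, and
  \<open>G\<close> is bounded there, so both sides pass to the limit; the L^p estimate on the ball
  of radius \<open>r\<close> then finishes.\<close>

lemma W1p0_gradient_pairing_bound:
  fixes w :: "'a::euclidean_space \<Rightarrow> 'a" and \<phi> :: "nat \<Rightarrow> 'a \<Rightarrow> real"
  assumes U: "open U" "bounded U" and p: "p > 1"
    and \<phi>: "\<And>n. \<phi> n \<in> test_functions U" and w: "w \<in> Lp U p"
    and lim: "(\<lambda>n. Lp_norm U p (\<lambda>x. grad (\<phi> n) x - w x)) \<longlonglongrightarrow> 0"
    and G: "continuous_on UNIV G" and A: "A \<ge> 0"
    and bound: "\<And>n. \<bar>integral\<^sup>L lborel (\<lambda>x. grad (\<phi> n) x \<bullet> G x)\<bar>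
      \<le> A * integral\<^sup>L lborel (\<lambda>x. indicator (ball 0 r) x * norm (grad (\<phi> n) x))"
    and r: "r > 0"
  shows "\<bar>integral\<^sup>L (lebesgue_on U) (\<lambda>x. w x \<bullet> G x)\<bar>
    \<le> A * (2 * measure lborel (ball (0::'a) r) powr (1 - 1 / p) * Lp_norm U p w)"
proof -
  let ?B = "ball (0::'a) r"
  let ?L = "lebesgue_on U"
  have Ul: "U \<in> lmeasurable" using U by (simp add: bounded_set_imp_lmeasurable)
  have Us: "U \<in> sets lebesgue" using Ul by auto
  have spU: "space ?L = U" by (simp add: space_restrict_space)
  have fin: "emeasure ?L S < \<infinity>" if "S \<in> sets ?L" for S
  proof -
    interpret finite_measure ?L using Ul by (rule finite_measure_lebesgue_on)
    show ?thesis using emeasure_finite[of S] by (metis infinity_ennreal_def top.not_eq_extremum)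
  qed
  have UBs: "U \<inter> ?B \<in> sets ?L" using Us by (auto simp: sets_restrict_space)
  obtain M where M: "M \<ge> 0" "\<And>x. x \<in> U \<Longrightarrow> norm (G x) \<le> M"
    using continuous_on_compact_norm_bound[OF _ G, of "closure U"] U(2) closure_subset[of U]
    by (metis compact_closure subsetD)
  have gc: "continuous_on UNIV (grad (\<phi> n))" for n
    using test_functions_Ck[OF \<phi>] by (rule continuous_on_grad)
  have gLp: "grad (\<phi> n) \<in> Lp U p" for n
  proof -
    obtain M where "\<And>x. x \<in> closure U \<Longrightarrow> norm (grad (\<phi> n) x) \<le> M"
      using continuous_on_compact_norm_bound[OF _ gc, of "closure U"] U(2) by (metis compact_closure)
    then show ?thesis
      using closure_subset[of U] p by (intro bounded_continuous_in_Lp[OF Ul _ gc, where M = M]) auto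
  qed
  define D where "D n x = grad (\<phi> n) x - w x" for n x
  have DLp: "D n \<in> Lp U p" for n
    unfolding D_def using p by (intro Lp_diff gLp w Us) auto
  have wi: "integrable ?L w" and Di: "integrable ?L (D n)" and gi: "integrable ?L (grad (\<phi> n))" for n
    using Lp_imp_integrable[OF Ul p] w DLp gLp by auto
  define \<delta> where "\<delta> n = integral\<^sup>L ?L (\<lambda>x. norm (D n x))" for n
  \<comment> \<open>The L^1 distance between the approximating gradients and \<open>w\<close> is
    controlled by the L^p distance because \<open>U\<close> has finite measure.\<close>
  have \<delta>: "\<delta> \<longlonglongrightarrow> 0"
  proof (rule tendsto_sandwich)
    show "\<forall>\<^sub>F n in sequentially. 0 \<le> \<delta> n" by (simp add: \<delta>_def integral_nonneg_AE)
    have "\<delta> n \<le> 2 * measure ?L U powr (1 - 1 / p) * Lp_norm U p (D n)" for n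
    proof -
      have "\<delta> n = integral\<^sup>L ?L (\<lambda>x. indicator U x * norm (D n x))"
        unfolding \<delta>_def by (intro Bochner_Integration.integral_cong) (auto simp: spU)
      also have "\<dots> \<le> 2 * measure ?L U powr (1 - 1 / p) * Lp_norm U p (D n)"
        unfolding Lp_norm_def using DLp[of n] fin[of U] Us
        by (intro integral_indicator_norm_le_Lp(2)[OF p]) (auto simp: Lp_def sets_restrict_space_iff)
      finally show ?thesis .
    qed
    then show "\<forall>\<^sub>F n in sequentially. \<delta> n \<le> 2 * measure ?L U powr (1 - 1 / p) * Lp_norm U p (D n)" by simp
    show "(\<lambda>n. 2 * measure ?L U powr (1 - 1 / p) * Lp_norm U p (D n)) \<longlonglongrightarrow> 0"
      using tendsto_mult_left[OF lim, of "2 * measure ?L U powr (1 - 1 / p)"] by (simp add: D_def[abs_def])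
  qed simp
  define W where "W = integral\<^sup>L ?L (\<lambda>x. indicator (U \<inter> ?B) x * norm (w x))"
  have Wi: "integrable ?L (\<lambda>x. indicator (U \<inter> ?B) x * norm (w x))"
    and W: "W \<le> 2 * measure ?L (U \<inter> ?B) powr (1 - 1 / p) * Lp_norm U p w"
    unfolding Lp_norm_def W_def using w fin[OF UBs] UBs
    by (intro integral_indicator_norm_le_Lp[OF p]; auto simp: Lp_def)+
  \<comment> \<open>Replacing \<open>w\<close> by the n-th gradient causes two errors:
    \<open>A * \<delta> n\<close> in the norm over the ball and \<open>M * \<delta> n\<close> in the
    pairing with \<open>G\<close>.\<close>
  have step: "\<bar>integral\<^sup>L ?L (\<lambda>x. w x \<bullet> G x)\<bar> \<le> A * (W + \<delta> n) + M * \<delta> n" for n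
  proof -
    have g0: "grad (\<phi> n) x = 0" if "x \<notin> U" for x using test_functions_outside(2)[OF \<phi> that] .
    have m1: "(\<lambda>x. grad (\<phi> n) x \<bullet> G x) \<in> borel_measurable borel"
      by (intro borel_measurable_continuous_onI continuous_intros gc G)
    have "(\<lambda>x. norm (grad (\<phi> n) x)) \<in> borel_measurable borel"
      by (intro borel_measurable_continuous_onI continuous_intros gc)
    then have m2: "(\<lambda>x. indicator ?B x * norm (grad (\<phi> n) x) :: real) \<in> borel_measurable borel"
      by (intro borel_measurable_times borel_measurable_indicator) auto
    have "\<bar>integral\<^sup>L ?L (\<lambda>x. grad (\<phi> n) x \<bullet> G x)\<bar>
        \<le> A * integral\<^sup>L ?L (\<lambda>x. indicator ?B x * norm (grad (\<phi> n) x))"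
      using bound[of n] g0 by (simp add: lebesgue_on_integral_eq_lborel[OF Us m1] lebesgue_on_integral_eq_lborel[OF Us m2])
    also have "\<dots> \<le> A * (W + \<delta> n)"
    proof (rule mult_left_mono[OF _ A])
      have "integral\<^sup>L ?L (\<lambda>x. indicator ?B x * norm (grad (\<phi> n) x))
          \<le> integral\<^sup>L ?L (\<lambda>x. indicator (U \<inter> ?B) x * norm (w x) + norm (D n x))"
      proof (rule integral_mono)
        have Bm: "indicator ?B \<in> borel_measurable ?L"
          using Us by (intro borel_measurable_indicator') (auto simp: sets_restrict_space)
        show "integrable ?L (\<lambda>x. indicator ?B x * norm (grad (\<phi> n) x))"
        proof (rule Bochner_Integration.integrable_bound[OF gi[of n]])
          show "(\<lambda>x. indicator ?B x * norm (grad (\<phi> n) x)) \<in> borel_measurable ?L"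
            using Bm gi[of n] by (intro borel_measurable_times borel_measurable_norm) auto
        qed (auto simp: indicator_def)
        show "integrable ?L (\<lambda>x. indicator (U \<inter> ?B) x * norm (w x) + norm (D n x))"
          using Wi Di[of n] by simp
        show "indicator ?B x * norm (grad (\<phi> n) x) \<le> indicator (U \<inter> ?B) x * norm (w x) + norm (D n x)"
          if "x \<in> space ?L" for x
          using that norm_triangle_ineq[of "w x" "D n x"] by (auto simp: spU indicator_def D_def)
      qed
      also have "\<dots> = W + \<delta> n" using Wi Di[of n] by (simp add: W_def \<delta>_def)
      finally show "integral\<^sup>L ?L (\<lambda>x. indicator ?B x * norm (grad (\<phi> n) x)) \<le> W + \<delta> n" .
    qed
    finally have 1: "\<bar>integral\<^sup>L ?L (\<lambda>x. grad (\<phi> n) x \<bullet> G x)\<bar> \<le> A * (W + \<delta> n)" .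
    have 2: "\<bar>integral\<^sup>L ?L (\<lambda>x. D n x \<bullet> G x)\<bar> \<le> M * \<delta> n"
      unfolding \<delta>_def using lebesgue_on_integral_norm_inner_bound(2)[OF Us Di G M(2)] .
    have "integral\<^sup>L ?L (\<lambda>x. w x \<bullet> G x) =
        integral\<^sup>L ?L (\<lambda>x. grad (\<phi> n) x \<bullet> G x - D n x \<bullet> G x)"
      by (simp add: D_def inner_diff_left)
    also have "\<dots> = integral\<^sup>L ?L (\<lambda>x. grad (\<phi> n) x \<bullet> G x) - integral\<^sup>L ?L (\<lambda>x. D n x \<bullet> G x)"
      by (intro Bochner_Integration.integral_diff lebesgue_on_integral_norm_inner_bound(1)[OF Us _ G M(2)] gi Di)
    finally show ?thesis using 1 2 by linarith
  qed
  have "(\<lambda>n. A * (W + \<delta> n) + M * \<delta> n) \<longlonglongrightarrow> A * (W + 0) + M * 0"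
    by (intro tendsto_intros \<delta>)
  then have "\<bar>integral\<^sup>L ?L (\<lambda>x. w x \<bullet> G x)\<bar> \<le> A * (W + 0) + M * 0"
    by (rule LIMSEQ_le_const) (use step in auto)
  also have "\<dots> = A * W" by simp
  also have "W \<le> 2 * measure lborel ?B powr (1 - 1 / p) * Lp_norm U p w"
  proof -
    have "measure ?L (U \<inter> ?B) = measure lebesgue (U \<inter> ?B)"
      using Us by (intro measure_restrict_space) auto
    also have "\<dots> \<le> measure lebesgue ?B"
      using Us by (intro measure_mono_fmeasurable) auto
    also have "\<dots> = measure lborel ?B" by simp
    finally have "measure ?L (U \<inter> ?B) powr (1 - 1 / p) \<le> measure lborel ?B powr (1 - 1 / p)"
      using p by (intro powr_mono2) auto
    then show ?thesis
      using W by (smt (verit) Lp_norm_def mult_right_mono powr_ge_zero)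
  qed
  finally show ?thesis using A by (simp add: mult_left_mono)
qed

subsection \<open>Testing the weak equation\<close>

text \<open>The test functions are \<open>R(|x|\<^sup>2)\<close> times cutoffs at distance \<open>1/n\<close> from the unit sphere; as \<open>R 1 = 0\<close>,
  the gradients remain bounded when the cutoffs are removed.\<close>

lemma weak_solution_pairing_radial:
  fixes f w :: "'a::euclidean_space \<Rightarrow> 'a" and R :: "real \<Rightarrow> real"
  assumes T: "closed T" "T \<subseteq> ball 0 1" and \<epsilon>: "0 < \<epsilon>" "\<epsilon> < 1"
    and w: "integrable (lebesgue_on (perforated_ball T \<epsilon>)) w"
    and eq: "\<And>\<phi>. \<phi> \<in> test_functions (perforated_ball T \<epsilon>) \<Longrightarrow>
      (\<integral>x. w x \<bullet> grad \<phi> x \<partial>lebesgue_on (perforated_ball T \<epsilon>))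
        = - (\<integral>x. f x \<bullet> grad \<phi> x \<partial>lebesgue_on (perforated_ball T \<epsilon>))"
    and div: "has_weak_div (ball 0 1) f g" and g: "integrable (lebesgue_on (ball 0 1)) g"
    and R: "\<And>k. Ck k R" "\<And>t. t \<le> \<epsilon>\<^sup>2 \<Longrightarrow> R t = 0" "R 1 = 0"
  shows "(\<integral>x. w x \<bullet> ((2 * deriv R (x \<bullet> x)) *\<^sub>R x) \<partial>lebesgue_on (perforated_ball T \<epsilon>))
    = (\<integral>x. g x * R (x \<bullet> x) \<partial>lebesgue_on (ball 0 1))"
proof -
  let ?U = "perforated_ball T \<epsilon>" and ?B = "ball (0::'a) 1"
  have U: "open ?U" "?U \<subseteq> ?B"
    unfolding perforated_ball_def using T by (auto intro!: open_Diff closed_scaling)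
  have Us: "?U \<in> sets lebesgue" using U(1) by auto
  have eT: "norm x < \<epsilon>" if "x \<in> (\<lambda>x. \<epsilon> *\<^sub>R x) ` T" for x
    using that T(2) \<epsilon> by (auto simp: subset_iff)
  have xx: "0 \<le> x \<bullet> x" "x \<bullet> x < 1" if "x \<in> ?B" for x
    using that by (auto simp: power2_norm_eq_inner[symmetric] power_less_one_iff abs_square_less_1)
  obtain \<sigma> :: "real \<Rightarrow> real" where \<sigma>: "\<And>k. Ck k \<sigma>" "\<And>t. t \<le> 1 \<Longrightarrow> \<sigma> t = 0"
    "\<And>t. t \<ge> 2 \<Longrightarrow> \<sigma> t = 1" "\<And>t. 0 \<le> \<sigma> t" "\<And>t. \<sigma> t \<le> 1"
    using smooth_step_exists by blast
  have d\<sigma>: "(\<sigma> has_real_derivative deriv \<sigma> t) (at t)" for t using Ck_Suc_realD(1)[OF \<sigma>(1)] .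
  have dR: "(R has_real_derivative deriv R t) (at t)" for t using Ck_Suc_realD(1)[OF R(1)] .
  have d\<sigma>c: "continuous_on UNIV (deriv \<sigma>)"
    using Ck_Suc_realD(2)[OF \<sigma>(1)[of "Suc 0"]] by (rule Ck_imp_continuous_on)
  have dRc: "continuous_on UNIV (deriv R)"
    using Ck_Suc_realD(2)[OF R(1)[of "Suc 0"]] by (rule Ck_imp_continuous_on)
  have d\<sigma>0: "deriv \<sigma> t = 0" if "t \<notin> {1..2}" for t
    using that deriv_eq_0_of_const_on_open[of "{..<1}" t \<sigma> 0] deriv_eq_0_of_const_on_open[of "{2<..}" t \<sigma> 1] \<sigma>(2,3)
    by force
  obtain S where S: "S \<ge> 0" "\<And>t. \<bar>deriv \<sigma> t\<bar> \<le> S"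
    using continuous_zero_outside_compact_bounded[OF d\<sigma>c compact_Icc d\<sigma>0] by blast
  obtain L where L: "L \<ge> 0" "\<And>t. t \<in> {0..1} \<Longrightarrow> \<bar>deriv R t\<bar> \<le> L"
    using continuous_on_compact_norm_bound[OF compact_Icc dRc, of 0 1] by (metis real_norm_def)
  \<comment> \<open>Linear decay at t = 1, from R(1) = 0 and the mean value theorem. It will
    compensate the steepness of the cutoff.\<close>
  have RL: "\<bar>R t\<bar> \<le> L * (1 - t)" if t: "0 \<le> t" "t < 1" for t
  proof -
    obtain s where s: "t < s" "s < 1" "R 1 - R t = (1 - t) * deriv R s"
      using MVT2[of t 1 R "deriv R"] dR t by blast
    then have "\<bar>R t\<bar> = (1 - t) * \<bar>deriv R s\<bar>"
      using R(3) t by (metis abs_minus_commute abs_mult abs_of_pos diff_0_right diff_gt_0_iff_gt)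
    also have "\<dots> \<le> (1 - t) * L" using L(2)[of s] s t by (intro mult_left_mono) auto
    finally show ?thesis by (simp add: mult.commute)
  qed
  define N where "N n = real n + 1" for n
  have N: "N n > 0" for n by (simp add: N_def)
  have Nlim: "filterlim N at_top sequentially"
    unfolding N_def by (rule filterlim_at_top_mono[OF filterlim_real_sequentially]) auto
  \<comment> \<open>The cutoff \<sigma>(N(1-t)) is 0 for t \<ge> 1 - 1/N and 1 for t \<le> 1 -
    2/N.\<close>
  define Rn where "Rn n t = R t * \<sigma> (N n - N n * t)" for n t
  define Dn where "Dn n t = deriv R t * \<sigma> (N n - N n * t) - R t * (N n * deriv \<sigma> (N n - N n * t))" for n t
  have Rn_Ck: "Ck k (Rn n)" for k n
    unfolding Rn_def
    by (rule Ck_mult[OF R(1) Ck_compose[OF \<sigma>(1) Ck_diff[OF Ck_const Ck_mult[OF Ck_const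
      Ck_bounded_linear[OF bounded_linear_ident]]]]])
  have Rn_D: "(Rn n has_real_derivative Dn n t) (at t)" for n t
  proof -
    have "((\<lambda>t. N n - N n * t) has_real_derivative (- N n)) (at t)"
      by (auto intro!: derivative_eq_intros)
    from DERIV_mult[OF dR DERIV_chain2[OF d\<sigma> this]]
    show ?thesis unfolding Rn_def by (rule DERIV_cong) (simp add: Dn_def algebra_simps)
  qed
  define \<phi> where "\<phi> n x = Rn n (x \<bullet> x)" for n and x :: 'a
  have grad\<phi>: "grad (\<phi> n) x = (2 * Dn n (x \<bullet> x)) *\<^sub>R x" for n x
    unfolding \<phi>_def by (rule grad_radial[OF Rn_D])
  have test: "\<phi> n \<in> test_functions ?U" for n
  proof -
    \<comment> \<open>This closed annulus carries the support: \<open>R\<close> vanishes inside the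
      radius \<epsilon>, which bounds the hole, and the cutoff vanishes near the unit
      sphere.\<close>
    define K where "K = {x::'a. \<epsilon>\<^sup>2 \<le> x \<bullet> x \<and> x \<bullet> x \<le> 1 - 1 / N n}"
    have "closed K" unfolding K_def
      by (intro closed_Collect_conj closed_Collect_le continuous_intros)
    have KB: "K \<subseteq> ?B"
    proof
      fix x assume "x \<in> K"
      then have "x \<bullet> x < 1" using N[of n] by (simp add: K_def) (smt (verit) divide_pos_pos)
      then show "x \<in> ?B" by (simp add: power2_norm_eq_inner[symmetric] abs_square_less_1)
    qed
    have "K \<subseteq> ?U"
    proof
      fix x assume x: "x \<in> K"
      then have "\<epsilon>\<^sup>2 \<le> (norm x)\<^sup>2" by (simp add: K_def power2_norm_eq_inner)
      then have "\<epsilon> \<le> norm x" by (rule power2_le_imp_le) simp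
      then show "x \<in> ?U" using x KB eT[of x] by (auto simp: perforated_ball_def)
    qed
    moreover have "{x. \<phi> n x \<noteq> 0} \<subseteq> K"
    proof
      fix x assume "x \<in> {x. \<phi> n x \<noteq> 0}"
      then have "R (x \<bullet> x) \<noteq> 0" "\<sigma> (N n - N n * (x \<bullet> x)) \<noteq> 0" by (auto simp: \<phi>_def Rn_def)
      then have "\<epsilon>\<^sup>2 < x \<bullet> x" "N n - N n * (x \<bullet> x) > 1" using R(2) \<sigma>(2) not_le by blast+
      then show "x \<in> K" using N[of n] by (simp add: K_def field_simps)
    qed
    then have "closure {x. \<phi> n x \<noteq> 0} \<subseteq> K" using \<open>closed K\<close> by (rule closure_minimal)
    moreover have "bounded K" using KB bounded_ball bounded_subset by blast
    ultimately show ?thesis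
      unfolding test_functions_def using Ck_compose[OF Rn_Ck Ck_inner_self]
      by (auto simp: \<phi>_def[abs_def] compact_eq_bounded_closed intro: bounded_subset)
  qed
  \<comment> \<open>The cutoff has derivative of size at most N S, but only where N(1-t) \<le> 2.
    There |R(t)| \<le> L(1-t), so the product is at most 2 L S, uniformly in
    \<open>n\<close>.\<close>
  have Dn_bound: "\<bar>Dn n t\<bar> \<le> L + 2 * L * S" if t: "0 \<le> t" "t < 1" for n t
  proof -
    have 1: "\<bar>deriv R t * \<sigma> (N n - N n * t)\<bar> \<le> L * 1"
      unfolding abs_mult using L t \<sigma>(4,5) by (intro mult_mono) auto
    have 2: "\<bar>R t * (N n * deriv \<sigma> (N n - N n * t))\<bar> \<le> 2 * L * S"
    proof (cases "N n - N n * t \<le> 2")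
      case True
      have "\<bar>R t * (N n * deriv \<sigma> (N n - N n * t))\<bar> = \<bar>R t\<bar> * N n * \<bar>deriv \<sigma> (N n - N n * t)\<bar>"
        using N[of n] by (simp add: abs_mult)
      also have "\<dots> \<le> L * (1 - t) * N n * S"
        using RL[OF t] N[of n] S t L by (intro mult_mono) auto
      also have "\<dots> = L * S * (N n - N n * t)" by (simp add: algebra_simps)
      also have "\<dots> \<le> L * S * 2" using True L S by (intro mult_left_mono) auto
      finally show ?thesis by simp
    next
      case False
      then show ?thesis using d\<sigma>0 L S by simp
    qed
    show ?thesis using 1 2 unfolding Dn_def by linarith
  qed
  \<comment> \<open>At a fixed point inside the ball the cutoff is eventually inactive, so the
    sequences in both limits below are eventually constant.\<close>
  have ev: "\<forall>\<^sub>F n in sequentially. Rn n t = R t \<and> Dn n t = deriv R t" if "t < 1" for t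
  proof -
    have "\<forall>\<^sub>F n in sequentially. N n > 2 / (1 - t)" using Nlim by (simp add: filterlim_at_top_dense)
    then show ?thesis
    proof eventually_elim
      case (elim n)
      then have "N n - N n * t > 2" using that by (simp add: field_simps)
      then show ?case using d\<sigma>0 \<sigma>(3) by (simp add: Rn_def Dn_def)
    qed
  qed
  have "(\<lambda>n. \<integral>x. w x \<bullet> grad (\<phi> n) x \<partial>lebesgue_on ?U) \<longlonglongrightarrow>
      (\<integral>x. w x \<bullet> ((2 * deriv R (x \<bullet> x)) *\<^sub>R x) \<partial>lebesgue_on ?U)"
  proof (rule integral_dominated_convergence[where w = "\<lambda>x. norm (w x) * (2 * (L + 2 * L * S))"])
    have spU: "space (lebesgue_on ?U) = ?U" by (simp add: space_restrict_space)
    have wm: "w \<in> borel_measurable (lebesgue_on ?U)" using w by simp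
    have "continuous_on UNIV (\<lambda>x::'a. (2 * deriv R (x \<bullet> x)) *\<^sub>R x)"
      by (intro continuous_intros continuous_on_compose2[OF dRc]) auto
    then have "(\<lambda>x. (2 * deriv R (x \<bullet> x)) *\<^sub>R x) \<in> borel_measurable (lebesgue_on ?U)"
      using Us by (intro continuous_imp_measurable_on_sets_lebesgue) (auto intro: continuous_on_subset)
    then show "(\<lambda>x. w x \<bullet> ((2 * deriv R (x \<bullet> x)) *\<^sub>R x)) \<in> borel_measurable (lebesgue_on ?U)"
      using wm by (intro borel_measurable_inner)
    have "continuous_on UNIV (grad (\<phi> n))" for n
      using test_functions_Ck[OF test] by (rule continuous_on_grad)
    then have "grad (\<phi> n) \<in> borel_measurable (lebesgue_on ?U)" for n
      using Us by (intro continuous_imp_measurable_on_sets_lebesgue) (auto intro: continuous_on_subset)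
    then show "(\<lambda>x. w x \<bullet> grad (\<phi> n) x) \<in> borel_measurable (lebesgue_on ?U)" for n
      using wm by (intro borel_measurable_inner)
    show "integrable (lebesgue_on ?U) (\<lambda>x. norm (w x) * (2 * (L + 2 * L * S)))" using w by simp
    show "AE x in lebesgue_on ?U. (\<lambda>n. w x \<bullet> grad (\<phi> n) x) \<longlonglongrightarrow> w x \<bullet> ((2 * deriv R (x \<bullet> x)) *\<^sub>R x)"
    proof (rule AE_I2)
      fix x assume "x \<in> space (lebesgue_on ?U)"
      then have "x \<in> ?B" using U spU by auto
      from ev[OF xx(2)[OF this]]
      have "\<forall>\<^sub>F n in sequentially. w x \<bullet> grad (\<phi> n) x = w x \<bullet> ((2 * deriv R (x \<bullet> x)) *\<^sub>R x)"
        by eventually_elim (simp add: grad\<phi>)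
      then show "(\<lambda>n. w x \<bullet> grad (\<phi> n) x) \<longlonglongrightarrow> w x \<bullet> ((2 * deriv R (x \<bullet> x)) *\<^sub>R x)"
        by (rule tendsto_eventually)
    qed
    show "AE x in lebesgue_on ?U. norm (w x \<bullet> grad (\<phi> n) x) \<le> norm (w x) * (2 * (L + 2 * L * S))" for n
    proof (rule AE_I2)
      fix x assume "x \<in> space (lebesgue_on ?U)"
      then have x: "x \<in> ?B" using U spU by auto
      have "norm (grad (\<phi> n) x) = 2 * \<bar>Dn n (x \<bullet> x)\<bar> * norm x" by (simp add: grad\<phi> abs_mult)
      also have "\<dots> \<le> 2 * (L + 2 * L * S) * 1"
        using Dn_bound[OF xx[OF x]] x L S by (intro mult_mono) auto
      finally have "norm (grad (\<phi> n) x) \<le> 2 * (L + 2 * L * S)" by simp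
      then show "norm (w x \<bullet> grad (\<phi> n) x) \<le> norm (w x) * (2 * (L + 2 * L * S))"
        using Cauchy_Schwarz_ineq2[of "w x" "grad (\<phi> n) x"]
          mult_left_mono[of "norm (grad (\<phi> n) x)" _ "norm (w x)"] by fastforce
    qed
  qed
  moreover have "(\<lambda>n. \<integral>x. g x * \<phi> n x \<partial>lebesgue_on ?B) \<longlonglongrightarrow> (\<integral>x. g x * R (x \<bullet> x) \<partial>lebesgue_on ?B)"
  proof (rule integral_dominated_convergence[where w = "\<lambda>x. norm (g x) * L"])
    have spB: "space (lebesgue_on ?B) = ?B" by (simp add: space_restrict_space)
    have gm: "g \<in> borel_measurable (lebesgue_on ?B)" using g by simp
    have "continuous_on UNIV (\<lambda>x::'a. R (x \<bullet> x))"
      using Ck_compose[OF R(1) Ck_inner_self] by (rule Ck_imp_continuous_on)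
    then have "(\<lambda>x. R (x \<bullet> x)) \<in> borel_measurable (lebesgue_on ?B)"
      by (intro continuous_imp_measurable_on_sets_lebesgue) (auto intro: continuous_on_subset)
    then show "(\<lambda>x. g x * R (x \<bullet> x)) \<in> borel_measurable (lebesgue_on ?B)"
      using gm by (intro borel_measurable_times)
    have "continuous_on UNIV (\<phi> n)" for n
      using test_functions_Ck[OF test] by (rule Ck_imp_continuous_on)
    then have "\<phi> n \<in> borel_measurable (lebesgue_on ?B)" for n
      by (intro continuous_imp_measurable_on_sets_lebesgue) (auto intro: continuous_on_subset)
    then show "(\<lambda>x. g x * \<phi> n x) \<in> borel_measurable (lebesgue_on ?B)" for n
      using gm by (intro borel_measurable_times)
    show "integrable (lebesgue_on ?B) (\<lambda>x. norm (g x) * L)" using g by simp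
    show "AE x in lebesgue_on ?B. (\<lambda>n. g x * \<phi> n x) \<longlonglongrightarrow> g x * R (x \<bullet> x)"
    proof (rule AE_I2)
      fix x assume "x \<in> space (lebesgue_on ?B)"
      then have "x \<in> ?B" using spB by auto
      from ev[OF xx(2)[OF this]]
      have "\<forall>\<^sub>F n in sequentially. g x * \<phi> n x = g x * R (x \<bullet> x)"
        by eventually_elim (simp add: \<phi>_def)
      then show "(\<lambda>n. g x * \<phi> n x) \<longlonglongrightarrow> g x * R (x \<bullet> x)"
        by (rule tendsto_eventually)
    qed
    show "AE x in lebesgue_on ?B. norm (g x * \<phi> n x) \<le> norm (g x) * L" for n
    proof (rule AE_I2)
      fix x assume "x \<in> space (lebesgue_on ?B)"
      then have x: "x \<in> ?B" using spB by auto
      have "\<bar>\<phi> n x\<bar> = \<bar>R (x \<bullet> x)\<bar> * \<sigma> (N n - N n * (x \<bullet> x))"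
        using \<sigma>(4) by (simp add: \<phi>_def Rn_def abs_mult)
      also have "\<dots> \<le> (L * (1 - x \<bullet> x)) * 1"
        using RL[OF xx[OF x]] \<sigma>(4,5) L xx[OF x] by (intro mult_mono) auto
      also have "\<dots> \<le> L" using L xx[OF x] by (simp add: mult_left_le)
      finally show "norm (g x * \<phi> n x) \<le> norm (g x) * L"
        by (simp add: abs_mult mult_left_mono)
    qed
  qed
  \<comment> \<open>The divergence identity holds on the whole ball and the weak equation on the
    perforated one. The two integrals involving \<open>f\<close> agree because the gradient of the
    test function vanishes off \<open>?U\<close>.\<close>
  moreover have "(\<integral>x. w x \<bullet> grad (\<phi> n) x \<partial>lebesgue_on ?U) = (\<integral>x. g x * \<phi> n x \<partial>lebesgue_on ?B)" for n
  proof -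
    have "\<phi> n \<in> test_functions ?B" using test[of n] U(2) by (auto simp: test_functions_def)
    then have "(\<integral>x. g x * \<phi> n x \<partial>lebesgue_on ?B) = - (\<integral>x. f x \<bullet> grad (\<phi> n) x \<partial>lebesgue_on ?B)"
      using div by (auto simp: has_weak_div_def)
    also have "(\<integral>x. f x \<bullet> grad (\<phi> n) x \<partial>lebesgue_on ?B) = (\<integral>x. f x \<bullet> grad (\<phi> n) x \<partial>lebesgue_on ?U)"
    proof -
      have "(\<integral>x. f x \<bullet> grad (\<phi> n) x \<partial>lebesgue_on ?B) = (\<integral>x. indicator ?B x *\<^sub>R (f x \<bullet> grad (\<phi> n) x) \<partial>lebesgue)"
        by (rule integral_restrict_space) auto
      also have "(\<lambda>x. indicator ?B x *\<^sub>R (f x \<bullet> grad (\<phi> n) x)) = (\<lambda>x. indicator ?U x *\<^sub>R (f x \<bullet> grad (\<phi> n) x))"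
        using U(2) test_functions_outside(2)[OF test[of n]] by (fastforce simp: indicator_def)
      also have "(\<integral>x. indicator ?U x *\<^sub>R (f x \<bullet> grad (\<phi> n) x) \<partial>lebesgue) = (\<integral>x. f x \<bullet> grad (\<phi> n) x \<partial>lebesgue_on ?U)"
        using Us by (intro integral_restrict_space[symmetric]) auto
      finally show ?thesis .
    qed
    finally show ?thesis using eq[OF test[of n]] by simp
  qed
  ultimately show ?thesis by (simp add: LIMSEQ_unique)
qed

subsection \<open>The truncated Green function\<close>

text \<open>The base \<rho>(t) = 1 + (t-1) \<sigma>(t) equals t for t \<ge> 2 and never drops below
  1, so its negative power is smooth on the whole line and at most 1. Multiplying by \<sigma> makes
  the profile vanish for t \<le> 1.\<close>

lemma fundamental_profile_exists:
  fixes s :: real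
  assumes s: "s \<ge> 0"
  obtains F :: "real \<Rightarrow> real" where "\<And>k. Ck k F" and "\<And>t. t \<le> 1 \<Longrightarrow> F t = 0"
    and "\<And>t. t \<ge> 2 \<Longrightarrow> F t = t powr (- s)" and "\<And>t. \<bar>F t\<bar> \<le> 1"
proof -
  obtain \<sigma> :: "real \<Rightarrow> real" where \<sigma>: "\<And>k. Ck k \<sigma>" "\<And>t. t \<le> 1 \<Longrightarrow> \<sigma> t = 0"
    "\<And>t. t \<ge> 2 \<Longrightarrow> \<sigma> t = 1" "\<And>t. 0 \<le> \<sigma> t" "\<And>t. \<sigma> t \<le> 1"
    using smooth_step_exists by blast
  define \<rho> where "\<rho> t = 1 + (t - 1) * \<sigma> t" for t
  have \<rho>1: "\<rho> t \<ge> 1" for t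
    using \<sigma>(2)[of t] \<sigma>(4)[of t] by (cases "t \<le> 1") (auto simp: \<rho>_def)
  have \<rho>0: "\<rho> t > 0" for t using \<rho>1[of t] by linarith
  have C\<rho>: "Ck k \<rho>" for k
    unfolding \<rho>_def
    by (rule Ck_add[OF Ck_const Ck_mult[OF Ck_diff[OF Ck_bounded_linear[OF bounded_linear_ident] Ck_const] \<sigma>(1)]])
  have \<rho>s: "\<rho> t powr (- s) \<le> 1" for t
    using \<rho>1[of t] s by (simp add: powr_minus_divide ge_one_powr_ge_zero)
  show thesis
  proof (rule that)
    show "Ck k (\<lambda>t. \<rho> t powr (- s) * \<sigma> t)" for k
      by (rule Ck_mult[OF Ck_powr[OF \<rho>0 C\<rho>] \<sigma>(1)])
    show "\<rho> t powr (- s) * \<sigma> t = 0" if "t \<le> 1" for t using \<sigma>(2)[OF that] by simp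
    show "\<rho> t powr (- s) * \<sigma> t = t powr (- s)" if "t \<ge> 2" for t
      using \<sigma>(3)[OF that] by (simp add: \<rho>_def)
    show "\<bar>\<rho> t powr (- s) * \<sigma> t\<bar> \<le> 1" for t
      using \<rho>s[of t] \<sigma>(4,5)[of t] by (simp add: abs_mult mult_le_one)
  qed
qed

text \<open>For t > 2 the expression equals 2 s (2s + 2 - d) t^(-s-1), so
  \<open>d = 2 * s + 2\<close> expresses the harmonicity of |x|^(2-d) away from the origin. For t <
  1 the profile is constant.\<close>

lemma fundamental_profile_harmonic:
  fixes F :: "real \<Rightarrow> real"
  assumes "\<And>t. t \<le> 1 \<Longrightarrow> F t = 0" and F: "\<And>t. t \<ge> 2 \<Longrightarrow> F t = t powr (- s)"
    and d: "d = 2 * s + 2" and t: "t \<notin> {1..2}"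
  shows "4 * t * deriv (deriv F) t + 2 * d * deriv F t = 0"
proof (cases "t < 1")
  case True
  have "deriv F u = 0" if "u \<in> {..<1}" for u
    by (rule deriv_eq_0_of_const_on_open[of "{..<1}" u F 0]) (use assms(1) that in auto)
  then show ?thesis
    using deriv_eq_0_of_const_on_open[of "{..<1}" t "deriv F" 0] True by simp
next
  case False
  with t have t2: "t > 2" by auto
  have d1: "((\<lambda>u. u powr r) has_real_derivative r * u powr (r - 1)) (at u)" if "u > 2" for r u :: real
    using that by (auto intro!: derivative_eq_intros)
  have F1: "deriv F u = - s * u powr (- s - 1)" if "u > 2" for u
    by (rule DERIV_imp_deriv, rule has_field_derivative_transform_within_open[OF d1[OF that, of "- s"], of "{2<..}"])
      (use that F in auto)
  have "((\<lambda>u. - s * u powr (- s - 1)) has_real_derivative - s * ((- s - 1) * t powr (- s - 1 - 1))) (at t)"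
    by (rule DERIV_cmult[OF d1[OF t2]])
  then have "(deriv F has_real_derivative - s * ((- s - 1) * t powr (- s - 1 - 1))) (at t)"
    by (rule has_field_derivative_transform_within_open[of _ _ _ "{2<..}"]) (use t2 F1 in auto)
  then have F2: "deriv (deriv F) t = - s * ((- s - 1) * t powr (- s - 1 - 1))" by (rule DERIV_imp_deriv)
  have "t * t powr (- s - 1 - 1) = t powr 1 * t powr (- s - 1 - 1)" using t2 by simp
  also have "\<dots> = t powr (- s - 1)"
  proof -
    have "1 + (- s - 1 - 1) = - s - 1" by simp
    then show ?thesis unfolding powr_add[symmetric] by (simp only:)
  qed
  finally have e: "t * t powr (- s - 1 - 1) = t powr (- s - 1)" .
  have "4 * t * deriv (deriv F) t + 2 * d * deriv F t
      = 4 * s * (s + 1) * (t * t powr (- s - 1 - 1)) - 2 * d * s * t powr (- s - 1)"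
    using F2 F1[OF t2] by (simp add: algebra_simps)
  also have "\<dots> = 0" unfolding e d by (simp add: algebra_simps)
  finally show ?thesis .
qed

text \<open>Dividing by \<epsilon>^k undoes the rescaling of the argument, so the truncated kernel
  agrees with |x|^(-k) wherever the truncation is inactive.\<close>

lemma powr_square_quotient:
  assumes "n > 0" "\<epsilon> > 0"
  shows "(n\<^sup>2 / \<epsilon>\<^sup>2) powr (- (real k / 2)) / \<epsilon> ^ k = 1 / n ^ k"
proof -
  have "n\<^sup>2 / \<epsilon>\<^sup>2 = (n / \<epsilon>) powr 2" using assms by (simp add: power_divide)
  then have "(n\<^sup>2 / \<epsilon>\<^sup>2) powr (- (real k / 2)) = (n / \<epsilon>) powr (- real k)"
    by (simp add: powr_powr)
  also have "\<dots> = \<epsilon> ^ k / n ^ k"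
    using assms by (simp add: powr_minus_divide powr_realpow power_divide)
  finally show ?thesis using assms by simp
qed

text \<open>Dominated convergence: at each x \<noteq> 0 the truncated kernel equals the Green
  function as soon as 2 \<epsilon>^2 \<le> |x|^2, and it is bounded by 2^k |x|^(-k) + 1 uniformly in
  \<epsilon>.\<close>

lemma truncated_green_function_tendsto:
  fixes g :: "'a::euclidean_space \<Rightarrow> real"
  assumes F: "continuous_on UNIV F" "\<And>t. t \<le> 1 \<Longrightarrow> F t = 0" "\<And>t. t \<ge> 2 \<Longrightarrow> F t = t powr (- (real k / 2))"
    "\<And>t. \<bar>F t\<bar> \<le> 1"
    and \<sigma>: "continuous_on UNIV \<sigma>" "\<And>t. t \<ge> 2 \<Longrightarrow> \<sigma> t = 1" "\<And>t. \<bar>\<sigma> t\<bar> \<le> 1"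
    and g: "integrable (lebesgue_on (ball 0 1)) g"
    and kg: "integrable (lebesgue_on (ball 0 1)) (\<lambda>x. (1 / norm x ^ k - 1) * g x)"
  shows "((\<lambda>\<epsilon>. \<integral>x. g x * (F ((x \<bullet> x) / \<epsilon>\<^sup>2) / \<epsilon> ^ k - \<sigma> ((x \<bullet> x) / \<epsilon>\<^sup>2)) \<partial>lebesgue_on (ball 0 1))
    \<longlongrightarrow> (\<integral>x. (1 / norm x ^ k - 1) * g x \<partial>lebesgue_on (ball 0 1))) (at_right 0)"
proof (rule tendsto_at_right_sequentially[of 0 1])
  fix S :: "nat \<Rightarrow> real"
  assume S: "\<And>n. 0 < S n" "\<And>n. S n < 1" "decseq S" "S \<longlonglongrightarrow> 0"
  let ?L = "lebesgue_on (ball (0::'a) 1)"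
  let ?R = "\<lambda>\<epsilon> (x::'a). F ((x \<bullet> x) / \<epsilon>\<^sup>2) / \<epsilon> ^ k - \<sigma> ((x \<bullet> x) / \<epsilon>\<^sup>2)"
  have far: "?R \<epsilon> x = 1 / norm x ^ k - 1" if "\<epsilon> > 0" "2 * \<epsilon>\<^sup>2 \<le> x \<bullet> x" for \<epsilon> and x :: 'a
  proof -
    have "x \<noteq> 0" using that by auto
    moreover have "(x \<bullet> x) / \<epsilon>\<^sup>2 \<ge> 2" using that by (simp add: field_simps)
    ultimately show ?thesis
      using F(3) \<sigma>(2) powr_square_quotient[of "norm x" \<epsilon> k] that by (simp add: power2_norm_eq_inner)
  qed
  have R_le: "\<bar>?R \<epsilon> x\<bar> \<le> 2 ^ k * (1 / norm x ^ k) + 1" if \<epsilon>: "\<epsilon> > 0" for \<epsilon> and x :: 'a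
  proof -
    have "\<bar>F ((x \<bullet> x) / \<epsilon>\<^sup>2) / \<epsilon> ^ k\<bar> \<le> 2 ^ k * (1 / norm x ^ k)"
    proof -
      consider "x \<bullet> x \<le> \<epsilon>\<^sup>2" | "2 * \<epsilon>\<^sup>2 \<le> x \<bullet> x" | "\<epsilon>\<^sup>2 < x \<bullet> x" "x \<bullet> x < 2 * \<epsilon>\<^sup>2" by linarith
      then show ?thesis
      proof cases
        case 1
        then show ?thesis using F(2) \<epsilon> by simp
      next
        case 2
        then have "x \<noteq> 0" using \<epsilon> by auto
        moreover have "(x \<bullet> x) / \<epsilon>\<^sup>2 \<ge> 2" using 2 \<epsilon> by (simp add: field_simps)
        ultimately have e: "F ((x \<bullet> x) / \<epsilon>\<^sup>2) / \<epsilon> ^ k = 1 / norm x ^ k"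
          using F(3) powr_square_quotient[of "norm x" \<epsilon> k] \<epsilon> by (simp add: power2_norm_eq_inner)
        show ?thesis
          unfolding e using mult_right_mono[of 1 "2 ^ k" "1 / norm x ^ k"] by simp
      next
        \<comment> \<open>In the transition region \<open>F\<close> is only known to be bounded by
          1; the factor 2^k arises from |x| \<le> 2\<epsilon>.\<close>
        case 3
        then have x: "norm x > 0" using \<epsilon> by (auto simp: not_le[symmetric])
        have "(norm x)\<^sup>2 \<le> (2 * \<epsilon>)\<^sup>2" using 3 by (simp add: power2_norm_eq_inner power_mult_distrib)
        then have "norm x \<le> 2 * \<epsilon>" using \<epsilon> by (intro power2_le_imp_le[of "norm x"]) auto
        then have "norm x ^ k \<le> 2 ^ k * \<epsilon> ^ k"
          unfolding power_mult_distrib[symmetric] by (intro power_mono) auto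
        then have "1 / \<epsilon> ^ k \<le> 2 ^ k * (1 / norm x ^ k)"
          using x \<epsilon> by (simp add: field_simps)
        moreover have "\<bar>F ((x \<bullet> x) / \<epsilon>\<^sup>2) / \<epsilon> ^ k\<bar> \<le> 1 / \<epsilon> ^ k"
          using F(4)[of "(x \<bullet> x) / \<epsilon>\<^sup>2"] \<epsilon> by (simp add: divide_right_mono)
        ultimately show ?thesis by linarith
      qed
    qed
    then show ?thesis using \<sigma>(3)[of "(x \<bullet> x) / \<epsilon>\<^sup>2"] by linarith
  qed
  show "(\<lambda>n. \<integral>x. g x * ?R (S n) x \<partial>?L) \<longlonglongrightarrow> (\<integral>x. (1 / norm x ^ k - 1) * g x \<partial>?L)"
  \<comment> \<open>The sum inside the first norm is |x|^(-k) g(x), written so that its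
    integrability follows from \<open>kg\<close> and \<open>g\<close>.\<close>
  proof (rule integral_dominated_convergence[where w = "\<lambda>x. 2 ^ k * norm ((1 / norm x ^ k - 1) * g x + g x) + norm (g x)"])
    show "(\<lambda>x. (1 / norm x ^ k - 1) * g x) \<in> borel_measurable ?L" using kg by simp
    show "(\<lambda>x. g x * ?R (S n) x) \<in> borel_measurable ?L" for n
    proof -
      have "continuous_on UNIV (?R (S n))"
        using S(1)[of n] by (intro continuous_intros continuous_on_compose2[OF F(1)] continuous_on_compose2[OF \<sigma>(1)]) auto
      then have "?R (S n) \<in> borel_measurable ?L"
        by (intro continuous_imp_measurable_on_sets_lebesgue) (auto intro: continuous_on_subset)
      with g show ?thesis by (intro borel_measurable_times) auto
    qed
    show "integrable ?L (\<lambda>x. 2 ^ k * norm ((1 / norm x ^ k - 1) * g x + g x) + norm (g x))"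
      using kg g by (intro Bochner_Integration.integrable_add integrable_mult_right integrable_norm)
    show "AE x in ?L. norm (g x * ?R (S n) x) \<le> 2 ^ k * norm ((1 / norm x ^ k - 1) * g x + g x) + norm (g x)" for n
    proof (rule AE_I2)
      fix x :: 'a
      have "norm (g x * ?R (S n) x) \<le> \<bar>g x\<bar> * (2 ^ k * (1 / norm x ^ k) + 1)"
        using R_le[OF S(1)[of n], of x] by (simp only: real_norm_def abs_mult) (intro mult_left_mono, auto)
      also have "\<dots> = 2 ^ k * norm ((1 / norm x ^ k - 1) * g x + g x) + norm (g x)"
        by (simp add: algebra_simps abs_mult)
      finally show "norm (g x * ?R (S n) x) \<le> 2 ^ k * norm ((1 / norm x ^ k - 1) * g x + g x) + norm (g x)" .
    qed
    \<comment> \<open>At the origin the truncation stays active for every \<epsilon>; as a null set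
      it can be discarded.\<close>
    have "AE x in ?L. x \<noteq> (0::'a)"
    proof (rule AE_I[of _ _ "{0}"])
      show "{0} \<in> sets ?L" by (auto simp: sets_restrict_space_iff)
      show "emeasure ?L {0} = 0" by (subst emeasure_restrict_space) auto
    qed auto
    then show "AE x in ?L. (\<lambda>n. g x * ?R (S n) x) \<longlonglongrightarrow> (1 / norm x ^ k - 1) * g x"
    proof eventually_elim
      case (elim x)
      have "(\<lambda>n. 2 * (S n)\<^sup>2) \<longlonglongrightarrow> 2 * 0\<^sup>2" by (intro tendsto_intros S(4))
      then have "\<forall>\<^sub>F n in sequentially. 2 * (S n)\<^sup>2 < x \<bullet> x"
        by (rule order_tendstoD) (use elim in simp)
      then have "\<forall>\<^sub>F n in sequentially. g x * ?R (S n) x = (1 / norm x ^ k - 1) * g x"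
        by eventually_elim (use far S(1) in simp)
      then show ?case by (rule tendsto_eventually)
    qed
  qed
qed simp

subsection \<open>Blow-up of the gradient\<close>

theorem theorem1p7:
  fixes T :: "'a::euclidean_space set"
    and f :: "'a \<Rightarrow> 'a"
    and div_f :: "'a \<Rightarrow> real"
    and u :: "real \<Rightarrow> 'a \<Rightarrow> real"
    and p q :: real
  assumes "DIM('a) \<ge> 4"
    and "closed_C1_domain T" and "T \<subseteq> ball 0 1"
    and "real DIM('a) < p"
    and "f \<in> Lp (ball 0 1) p"
    and "has_weak_div (ball 0 1) f div_f"
    and "q > real DIM('a) / 2"
    and "div_f \<in> Lp (ball 0 1) q"
    and "(\<integral>y. (1 / norm y ^ (DIM('a) - 2) - 1) * div_f y \<partial>lebesgue_on (ball 0 1)) \<noteq> 0"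
    and "\<And>\<epsilon>. 0 < \<epsilon> \<Longrightarrow> \<epsilon> < 1 \<Longrightarrow> weak_dirichlet_solution (perforated_ball T \<epsilon>) p f (u \<epsilon>)"
  shows "Liminf (at_right 0) (\<lambda>\<epsilon>. ereal (Lp_norm (perforated_ball T \<epsilon>) p
           (weak_grad (perforated_ball T \<epsilon>) (u \<epsilon>)))) = \<infinity>"
proof -
  note d4 = assms(1) and dom = assms(2) and TB = assms(3) and dp = assms(4) and f = assms(5)
    and div = assms(6) and dq = assms(7) and gq = assms(8) and I0 = assms(9) and sol = assms(10)
  let ?B = "ball (0::'a) 1" and ?d = "DIM('a)"
  define k where "k = ?d - 2"
  \<comment> \<open>Profiles take the squared norm as argument, so |x|^(2-d) becomes
    \<open>t powr (- s)\<close> at t = |x|^2.\<close>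
  define s where "s = real k / 2"
  have dk: "?d = k + 2" using d4 by (simp add: k_def)
  have p1: "p > 1" and q1: "q > 1" using dp dq d4 by auto
  have s: "s \<ge> 0" "real ?d = 2 * s + 2" by (simp_all add: s_def dk)
  obtain D where D: "C1_domain D" "T = closure D" using dom by (auto simp: closed_C1_domain_def)
  have Tc: "closed T" using D by simp
  \<comment> \<open>A ball inside the hole, where the solution vanishes after scaling by \<epsilon>.
    Its radius is cut down to at most 1, as \<open>radial_pairing_bound\<close> requires.\<close>
  obtain z \<rho> where z: "z \<in> ball 0 1" and \<rho>: "0 < \<rho>" "\<rho> \<le> 1" and zT: "ball z \<rho> \<subseteq> T"
  proof -
    obtain z where zD: "z \<in> D" using D(1) by (auto simp: C1_domain_def)
    moreover have "open D" using D(1) by (simp add: C1_domain_def)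
    ultimately obtain r where r: "r > 0" "ball z r \<subseteq> D" using openE by blast
    have DT: "D \<subseteq> T" using D(2) closure_subset by blast
    have "z \<in> ball 0 1" using zD DT TB by blast
    moreover have "ball z (min r 1) \<subseteq> T" using r(2) DT by (auto simp: subset_iff)
    ultimately show thesis using that[of z "min r 1"] r(1) by simp
  qed
  obtain \<sigma> :: "real \<Rightarrow> real" where \<sigma>: "\<And>k. Ck k \<sigma>" "\<And>t. t \<le> 1 \<Longrightarrow> \<sigma> t = 0"
    "\<And>t. t \<ge> 2 \<Longrightarrow> \<sigma> t = 1" "\<And>t. 0 \<le> \<sigma> t" "\<And>t. \<sigma> t \<le> 1"
    using smooth_step_exists by blast
  obtain F :: "real \<Rightarrow> real" where F: "\<And>k. Ck k F" "\<And>t. t \<le> 1 \<Longrightarrow> F t = 0"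
    "\<And>t. t \<ge> 2 \<Longrightarrow> F t = t powr (- s)" "\<And>t. \<bar>F t\<bar> \<le> 1"
    using fundamental_profile_exists[OF s(1)] by blast
  have F_harm: "4 * t * deriv (deriv F) t + 2 * real ?d * deriv F t = 0" if "t \<notin> {1..2}" for t
    by (rule fundamental_profile_harmonic[OF F(2,3) s(2) that])
  \<comment> \<open>The constant -1 in the Green function is truncated too, by \<sigma>, which is
    locally constant and hence trivially harmonic outside the transition range.\<close>
  have \<sigma>_harm: "4 * t * deriv (deriv \<sigma>) t + 2 * real ?d * deriv \<sigma> t = 0" if "t \<notin> {1..2}" for t
  proof -
    have 0: "deriv \<sigma> u = 0" if "u \<in> - {1..2}" for u
      using that deriv_eq_0_of_const_on_open[of "{..<1}" u \<sigma> 0]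
        deriv_eq_0_of_const_on_open[of "{2<..}" u \<sigma> 1] \<sigma>(2,3) by force
    have "deriv (deriv \<sigma>) t = 0"
      by (rule deriv_eq_0_of_const_on_open[of "- {1..2}"]) (use that 0 in auto)
    then show ?thesis using 0 that by simp
  qed
  \<comment> \<open>This is the gradient of H(|x|^2 / \<epsilon>^2). The constants obtained next for
    H = F and H = \<sigma> do not depend on \<epsilon>.\<close>
  define GG where "GG H \<epsilon> x = (2 / \<epsilon>\<^sup>2 * deriv H ((x \<bullet> x) / \<epsilon>\<^sup>2)) *\<^sub>R x" for H :: "real \<Rightarrow> real" and \<epsilon> and x :: 'a
  obtain C1 where C1: "C1 \<ge> 0" "\<And>\<epsilon> \<phi>. \<epsilon> > 0 \<Longrightarrow> \<phi> \<in> test_functions UNIV \<Longrightarrow>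
      \<forall>x. dist (\<epsilon> *\<^sub>R z) x < \<epsilon> * \<rho> \<longrightarrow> \<phi> x = 0 \<Longrightarrow>
      \<bar>integral\<^sup>L lborel (\<lambda>x::'a. grad \<phi> x \<bullet> GG F \<epsilon> x)\<bar>
        \<le> C1 / \<epsilon> * integral\<^sup>L lborel (\<lambda>x. indicator (ball 0 (2 * \<epsilon>)) x * norm (grad \<phi> x))"
    unfolding GG_def using radial_pairing_bound[OF F(1) F_harm z \<rho>] by blast
  obtain C2 where C2: "C2 \<ge> 0" "\<And>\<epsilon> \<phi>. \<epsilon> > 0 \<Longrightarrow> \<phi> \<in> test_functions UNIV \<Longrightarrow>
      \<forall>x. dist (\<epsilon> *\<^sub>R z) x < \<epsilon> * \<rho> \<longrightarrow> \<phi> x = 0 \<Longrightarrow>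
      \<bar>integral\<^sup>L lborel (\<lambda>x::'a. grad \<phi> x \<bullet> GG \<sigma> \<epsilon> x)\<bar>
        \<le> C2 / \<epsilon> * integral\<^sup>L lborel (\<lambda>x. indicator (ball 0 (2 * \<epsilon>)) x * norm (grad \<phi> x))"
    unfolding GG_def using radial_pairing_bound[OF \<sigma>(1) \<sigma>_harm z \<rho>] by blast
  have gi: "integrable (lebesgue_on ?B) div_f"
    by (rule Lp_imp_integrable[OF _ q1 gq]) simp
  define I where "I = (\<integral>y. (1 / norm y ^ k - 1) * div_f y \<partial>lebesgue_on ?B)"
  have I: "I \<noteq> 0" using I0 by (simp add: I_def k_def)
  \<comment> \<open>The Bochner integral of a non-integrable function is \<open>0\<close>, so \<open>I \<noteq> 0\<close> yields integrability.\<close>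
  have kgi: "integrable (lebesgue_on ?B) (\<lambda>y. (1 / norm y ^ k - 1) * div_f y)"
    using I not_integrable_integral_eq unfolding I_def by blast
  define J where "J \<epsilon> = (\<integral>x. div_f x * (F ((x \<bullet> x) / \<epsilon>\<^sup>2) / \<epsilon> ^ k - \<sigma> ((x \<bullet> x) / \<epsilon>\<^sup>2)) \<partial>lebesgue_on ?B)" for \<epsilon>
  have J_lim: "(J \<longlongrightarrow> I) (at_right 0)"
    unfolding J_def I_def
  proof (rule truncated_green_function_tendsto[OF _ F(2) _ F(4) _ \<sigma>(3) _ gi kgi])
    show "continuous_on UNIV F" using F(1) by (rule Ck_imp_continuous_on)
    show "continuous_on UNIV \<sigma>" using \<sigma>(1) by (rule Ck_imp_continuous_on)
    show "F t = t powr (- (real k / 2))" if "t \<ge> 2" for t using F(3)[OF that] by (simp add: s_def)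
    show "\<bar>\<sigma> t\<bar> \<le> 1" for t using \<sigma>(4,5) by simp
  qed
  \<comment> \<open>The volume of the ball of radius 2, so that the ball of radius 2\<epsilon> has
    volume V \<epsilon>^d.\<close>
  define V where "V = unit_ball_vol (real ?d) * 2 ^ ?d"
  have V: "V > 0" by (simp add: V_def)
  define N where "N \<epsilon> = Lp_norm (perforated_ball T \<epsilon>) p (weak_grad (perforated_ball T \<epsilon>) (u \<epsilon>))" for \<epsilon>
  define a where "a = 1 - real ?d / p"
  have a: "a > 0" using dp by (simp add: a_def)
  \<comment> \<open>The added 1 makes \<open>K\<close> positive even if \<open>C1\<close> and
    \<open>C2\<close> are both 0, so that it can be divided by at the end.\<close>
  define K where "K = (C1 + C2) * 2 * V powr (1 - 1 / p) + 1"
  have K: "K > 0" using C1(1) C2(1) by (simp add: K_def add_nonneg_pos)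

  \<comment> \<open>Estimate at a fixed size of the hole\<close>
  have main: "\<bar>J \<epsilon>\<bar> \<le> K * \<epsilon> powr a * N \<epsilon>" if \<epsilon>: "0 < \<epsilon>" "\<epsilon> < 1 / 2" for \<epsilon>
  proof -
    have \<epsilon>1: "\<epsilon> < 1" using \<epsilon> by simp
    have "\<epsilon>\<^sup>2 \<le> (1 / 2)\<^sup>2" using \<epsilon> by (intro power_mono) auto
    \<comment> \<open>This ensures that the truncation is inactive on the unit sphere, which gives
      R(1) = \<epsilon>^k / \<epsilon>^k - 1 = 0 below.\<close>
    then have \<epsilon>2: "2 \<le> 1 / \<epsilon>\<^sup>2" using \<epsilon> by (simp add: field_simps)
    let ?U = "perforated_ball T \<epsilon>"
    define w where "w = weak_grad ?U (u \<epsilon>)"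
    have U: "open ?U" "?U \<subseteq> ?B" "bounded ?U"
      unfolding perforated_ball_def using Tc by (auto intro!: open_Diff closed_scaling bounded_subset[OF bounded_ball])
    have sol': "u \<epsilon> \<in> W1p0 ?U p" "\<And>\<phi>. \<phi> \<in> test_functions ?U \<Longrightarrow>
        (\<integral>x. w x \<bullet> grad \<phi> x \<partial>lebesgue_on ?U) = - (\<integral>x. f x \<bullet> grad \<phi> x \<partial>lebesgue_on ?U)"
      using sol[OF \<epsilon>(1) \<epsilon>1] by (auto simp: weak_dirichlet_solution_def w_def)
    have wLp: "w \<in> Lp ?U p" using sol'(1) by (auto simp: W1p0_def W1p_def w_def)
    obtain \<phi> where \<phi>: "\<And>n. \<phi> n \<in> test_functions ?U"
        "(\<lambda>n. Lp_norm ?U p (\<lambda>x. grad (\<phi> n) x - w x)) \<longlonglongrightarrow> 0"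
      using sol'(1) by (auto simp: W1p0_def w_def)
    have wi: "integrable (lebesgue_on ?U) w"
      using U by (intro Lp_imp_integrable[OF _ p1 wLp]) (simp add: bounded_set_imp_lmeasurable)
    \<comment> \<open>The truncated Green function as a function of t = |x|^2; it vanishes for t
      \<le> \<epsilon>^2 and at t = 1.\<close>
    define R where "R t = F (1 / \<epsilon>\<^sup>2 * t) * (1 / \<epsilon> ^ k) - \<sigma> (1 / \<epsilon>\<^sup>2 * t)" for t
    have RC: "Ck n R" for n
      unfolding R_def by (rule Ck_diff[OF Ck_mult[OF Ck_scale[OF F(1)] Ck_const] Ck_scale[OF \<sigma>(1)]])
    have dR: "deriv R t = 1 / \<epsilon>\<^sup>2 * deriv F (1 / \<epsilon>\<^sup>2 * t) * (1 / \<epsilon> ^ k) - 1 / \<epsilon>\<^sup>2 * deriv \<sigma> (1 / \<epsilon>\<^sup>2 * t)" for t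
    proof -
      have "((\<lambda>t. F (1 / \<epsilon>\<^sup>2 * t) * (1 / \<epsilon> ^ k)) has_real_derivative
          1 / \<epsilon>\<^sup>2 * deriv F (1 / \<epsilon>\<^sup>2 * t) * (1 / \<epsilon> ^ k)) (at t)"
        by (rule DERIV_cmult_right[OF deriv_scale[OF F(1)]])
      from DERIV_diff[OF this deriv_scale[OF \<sigma>(1), of "1 / \<epsilon>\<^sup>2" t]]
      show ?thesis unfolding R_def[abs_def] by (rule DERIV_imp_deriv)
    qed
    define G where "G x = (2 * deriv R (x \<bullet> x)) *\<^sub>R x" for x :: 'a
    have G_eq: "G x = (1 / \<epsilon> ^ k) *\<^sub>R GG F \<epsilon> x - GG \<sigma> \<epsilon> x" for x
    proof -
      have "2 * deriv R (x \<bullet> x) = 1 / \<epsilon> ^ k * (2 / \<epsilon>\<^sup>2 * deriv F ((x \<bullet> x) / \<epsilon>\<^sup>2)) - 2 / \<epsilon>\<^sup>2 * deriv \<sigma> ((x \<bullet> x) / \<epsilon>\<^sup>2)"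
        by (simp add: dR)
      then show ?thesis by (simp only: G_def GG_def scaleR_diff_left scaleR_scaleR)
    qed
    have GG_cont: "continuous_on UNIV (GG H \<epsilon>)" if "\<And>n. Ck n H" for H
      unfolding GG_def
      by (intro continuous_intros continuous_on_compose2[OF Ck_imp_continuous_on[OF Ck_Suc_realD(2)[OF that[of "Suc 0"]]]])
        (use \<epsilon> in auto)
    have G_cont: "continuous_on UNIV G"
      unfolding G_eq by (intro continuous_intros GG_cont F(1) \<sigma>(1))
    have pair: "(\<integral>x. w x \<bullet> G x \<partial>lebesgue_on ?U) = (\<integral>x. div_f x * R (x \<bullet> x) \<partial>lebesgue_on ?B)"
      unfolding G_def
    proof (rule weak_solution_pairing_radial[OF Tc TB \<epsilon>(1) \<epsilon>1 wi sol'(2) div gi RC])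
      show "R t = 0" if "t \<le> \<epsilon>\<^sup>2" for t
        using that \<epsilon> F(2)[of "t / \<epsilon>\<^sup>2"] \<sigma>(2)[of "t / \<epsilon>\<^sup>2"] by (simp add: R_def)
      show "R 1 = 0"
        using F(3)[OF \<epsilon>2] \<sigma>(3)[OF \<epsilon>2] powr_square_quotient[of 1 \<epsilon> k] \<epsilon> by (simp add: R_def s_def)
    qed
    also have "\<dots> = J \<epsilon>" by (simp add: J_def R_def)
    finally have J_eq: "J \<epsilon> = (\<integral>x. w x \<bullet> G x \<partial>lebesgue_on ?U)" by simp
    \<comment> \<open>The power \<epsilon>^(-k) comes from the normalisation of the fundamental
      solution, and one more factor 1/\<epsilon> from \<open>radial_pairing_bound\<close>.\<close>
    define A where "A = (C1 + C2) / \<epsilon> ^ (k + 1)"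
    have "\<bar>\<integral>x. w x \<bullet> G x \<partial>lebesgue_on ?U\<bar>
        \<le> A * (2 * measure lborel (ball (0::'a) (2 * \<epsilon>)) powr (1 - 1 / p) * Lp_norm ?U p w)"
    proof (rule W1p0_gradient_pairing_bound[OF U(1,3) p1 \<phi>(1) wLp \<phi>(2) G_cont])
      show "A \<ge> 0" using C1(1) C2(1) \<epsilon> by (simp add: A_def)
      show "2 * \<epsilon> > 0" using \<epsilon> by simp
      fix n
      let ?N = "integral\<^sup>L lborel (\<lambda>x. indicator (ball 0 (2 * \<epsilon>)) x * norm (grad (\<phi> n) x))"
      have N0: "?N \<ge> 0" by (simp add: integral_nonneg_AE)
      have \<phi>C: "Ck 1 (\<phi> n)" using \<phi>(1) by (rule test_functions_Ck)
      have \<phi>UNIV: "\<phi> n \<in> test_functions UNIV" using \<phi>(1)[of n] by (simp add: test_functions_def)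
      define S where "S = closure {x. \<phi> n x \<noteq> 0}"
      have S: "compact S" "\<And>x. x \<notin> S \<Longrightarrow> \<phi> n x = 0"
        using \<phi>(1)[of n] closure_subset[of "{x. \<phi> n x \<noteq> 0}"] by (auto simp: S_def test_functions_def)
      have gS: "grad (\<phi> n) x = 0" if "x \<notin> S" for x
        using that unfolding S_def by (rule grad_eq_0_outside_closure)
      \<comment> \<open>The ball of radius \<epsilon> \<rho> around \<epsilon> z is the scaled copy
        of the ball inside \<open>T\<close>, hence lies in the hole.\<close>
      have zero: "\<phi> n x = 0" if "dist (\<epsilon> *\<^sub>R z) x < \<epsilon> * \<rho>" for x
      proof -
        have "x = \<epsilon> *\<^sub>R (x /\<^sub>R \<epsilon>)" using \<epsilon> by simp
        moreover have "x /\<^sub>R \<epsilon> \<in> T"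
        proof -
          have "dist (\<epsilon> *\<^sub>R z) x = dist (\<epsilon> *\<^sub>R z) (\<epsilon> *\<^sub>R (x /\<^sub>R \<epsilon>))" using \<epsilon> by simp
          also have "dist (\<epsilon> *\<^sub>R z) (\<epsilon> *\<^sub>R (x /\<^sub>R \<epsilon>)) = \<epsilon> * dist z (x /\<^sub>R \<epsilon>)" using \<epsilon> by (simp only: dist_norm scaleR_diff_right[symmetric] norm_scaleR)
          finally have "dist z (x /\<^sub>R \<epsilon>) < \<rho>" using that \<epsilon> by simp
          then show ?thesis using zT by (auto simp: subset_iff)
        qed
        ultimately have "x \<notin> ?U" unfolding perforated_ball_def by blast
        then show ?thesis using test_functions_outside(1)[OF \<phi>(1)] by blast
      qed
      have int: "integrable lborel (\<lambda>x. grad (\<phi> n) x \<bullet> GG H \<epsilon> x)" if "\<And>n. Ck n H" for H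
        using gS by (intro integrable_compact_support[OF _ S(1)] continuous_intros GG_cont that continuous_on_grad \<phi>C) auto
      have "integral\<^sup>L lborel (\<lambda>x. grad (\<phi> n) x \<bullet> G x)
          = 1 / \<epsilon> ^ k * integral\<^sup>L lborel (\<lambda>x. grad (\<phi> n) x \<bullet> GG F \<epsilon> x) - integral\<^sup>L lborel (\<lambda>x. grad (\<phi> n) x \<bullet> GG \<sigma> \<epsilon> x)"
        unfolding G_eq inner_diff_right inner_scaleR_right
        using int[OF F(1)] int[OF \<sigma>(1)] by (simp del: times_divide_eq_left)
      also have "\<bar>\<dots>\<bar> \<le> 1 / \<epsilon> ^ k * \<bar>integral\<^sup>L lborel (\<lambda>x. grad (\<phi> n) x \<bullet> GG F \<epsilon> x)\<bar>
          + \<bar>integral\<^sup>L lborel (\<lambda>x. grad (\<phi> n) x \<bullet> GG \<sigma> \<epsilon> x)\<bar>"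
        by (rule order_trans[OF abs_triangle_ineq4]) (use \<epsilon> in \<open>simp add: abs_mult\<close>)
      also have "\<dots> \<le> 1 / \<epsilon> ^ k * (C1 / \<epsilon> * ?N) + 1 / \<epsilon> ^ k * (C2 / \<epsilon> * ?N)"
      proof (intro add_mono mult_left_mono)
        show "\<bar>integral\<^sup>L lborel (\<lambda>x. grad (\<phi> n) x \<bullet> GG F \<epsilon> x)\<bar> \<le> C1 / \<epsilon> * ?N"
          by (rule C1(2)[OF \<epsilon>(1) \<phi>UNIV]) (use zero in blast)
        have "\<bar>integral\<^sup>L lborel (\<lambda>x. grad (\<phi> n) x \<bullet> GG \<sigma> \<epsilon> x)\<bar> \<le> C2 / \<epsilon> * ?N"
          by (rule C2(2)[OF \<epsilon>(1) \<phi>UNIV]) (use zero in blast)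
        \<comment> \<open>The \<sigma> part is only of order 1/\<epsilon>. Since \<epsilon> < 1,
          weakening it by \<epsilon>^(-k) lets both parts share the constant
          \<open>A\<close>.\<close>
        also have "\<dots> \<le> 1 / \<epsilon> ^ k * (C2 / \<epsilon> * ?N)"
        proof -
          have "1 \<le> 1 / \<epsilon> ^ k" using \<epsilon> \<epsilon>1 by (simp add: power_le_one)
          from mult_right_mono[OF this, of "C2 / \<epsilon> * ?N"] show ?thesis
            using C2(1) \<epsilon> N0 by simp
        qed
        finally show "\<bar>integral\<^sup>L lborel (\<lambda>x. grad (\<phi> n) x \<bullet> GG \<sigma> \<epsilon> x)\<bar> \<le> 1 / \<epsilon> ^ k * (C2 / \<epsilon> * ?N)" .
      qed (use \<epsilon> in simp)
      also have "\<dots> = A * ?N" using \<epsilon> by (simp add: A_def field_simps)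
      finally show "\<bar>integral\<^sup>L lborel (\<lambda>x. grad (\<phi> n) x \<bullet> G x)\<bar> \<le> A * ?N" .
    qed
    also have "measure lborel (ball (0::'a) (2 * \<epsilon>)) = V * \<epsilon> powr real ?d"
      using \<epsilon> by (simp add: content_ball V_def power_mult_distrib powr_realpow)
    also have "A * (2 * (V * \<epsilon> powr real ?d) powr (1 - 1 / p) * Lp_norm ?U p w)
        = (K - 1) * \<epsilon> powr a * N \<epsilon>"
    proof -
      \<comment> \<open>As k + 1 = d - 1, the volume power \<epsilon>^(d - d/p) against
        \<epsilon>^(-(d-1)) leaves the exponent 1 - d/p.\<close>
      have e: "real ?d * (1 - 1 / p) - real (k + 1) = a"
        using p1 by (simp add: a_def dk field_simps)
      have "\<epsilon> powr (real ?d * (1 - 1 / p)) / \<epsilon> ^ (k + 1) = \<epsilon> powr a"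
        unfolding e[symmetric] powr_diff using \<epsilon> by (simp add: powr_realpow del: of_nat_add of_nat_Suc)
      moreover have "(V * \<epsilon> powr real ?d) powr (1 - 1 / p) = V powr (1 - 1 / p) * \<epsilon> powr (real ?d * (1 - 1 / p))"
        using V by (simp add: powr_mult powr_powr)
      then have "A * (2 * (V * \<epsilon> powr real ?d) powr (1 - 1 / p) * Lp_norm ?U p w)
          = (C1 + C2) * 2 * V powr (1 - 1 / p) * (\<epsilon> powr (real ?d * (1 - 1 / p)) / \<epsilon> ^ (k + 1)) * N \<epsilon>"
        by (simp add: A_def N_def w_def mult_ac)
      ultimately show ?thesis by (simp add: K_def)
    qed
    also have "\<dots> \<le> K * \<epsilon> powr a * N \<epsilon>"
      by (intro mult_right_mono) (auto simp: N_def Lp_norm_def)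
    finally show ?thesis using J_eq by simp
  qed

  \<comment> \<open>Passage to the limit as the hole shrinks\<close>
  have "filterlim (\<lambda>\<epsilon>. \<bar>J \<epsilon>\<bar> * inverse (K * \<epsilon> powr a)) at_top (at_right 0)"
  proof (rule filterlim_tendsto_pos_mult_at_top)
    show "((\<lambda>\<epsilon>. \<bar>J \<epsilon>\<bar>) \<longlongrightarrow> \<bar>I\<bar>) (at_right 0)" by (rule tendsto_rabs[OF J_lim])
    show "\<bar>I\<bar> > 0" using I by simp
    have "eventually ((\<le>) 0) (at_right (0::real))" by (rule eventually_at_rightI[of 0 1]) auto
    then have "((\<lambda>\<epsilon>. \<epsilon> powr a) \<longlongrightarrow> 0) (at_right (0::real))"
      using tendsto_powr'[of "\<lambda>\<epsilon>. \<epsilon>" "0::real" "at_right 0" "\<lambda>_. a" a] a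
      by (simp add: tendsto_ident_at)
    then have "((\<lambda>\<epsilon>. K * \<epsilon> powr a) \<longlongrightarrow> K * 0) (at_right 0)" by (intro tendsto_intros)
    then show "filterlim (\<lambda>\<epsilon>. inverse (K * \<epsilon> powr a)) at_top (at_right 0)"
      using K by (intro filterlim_inverse_at_top) (auto intro!: eventually_at_rightI[of 0 1])
  qed
  then have "filterlim N at_top (at_right 0)"
  proof (rule filterlim_at_top_mono)
    show "\<forall>\<^sub>F \<epsilon> in at_right 0. \<bar>J \<epsilon>\<bar> * inverse (K * \<epsilon> powr a) \<le> N \<epsilon>"
      using main K by (intro eventually_at_rightI[of 0 "1 / 2"]) (auto simp: field_simps)
  qed
  then have "((\<lambda>\<epsilon>. ereal (N \<epsilon>)) \<longlongrightarrow> \<infinity>) (at_right 0)" by (simp add: tendsto_PInfty_eq_at_top)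
  then show ?thesis unfolding N_def by (intro lim_imp_Liminf) auto
qed

end
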